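(* Let $\varphi$ be an endomorphism of the free group $FG(A)$ on a finite set $A$ and let $\hat\varphi$ be its unique extension to a continuous endomorphism of the free profinite group $\overline\Omega_A\mathsf G$. Then the profinite group presented by $$\langle A\mid\hat\varphi^{\,\omega}(a)=a\ (a\in A)\rangle_{\mathsf G}$$ is decidable.
   Context: $\mathsf G$ is the class of all finite groups and $\overline\Omega_A\mathsf G$ is the free profinite group on $A$, which contains $FG(A)$ as a dense subgroup. The monoid of continuous endomorphisms of $\overline\Omega_A\mathsf G$ is profinite under pointwise convergence, and $\hat\varphi^{\,\omega}=\lim_n\hat\varphi^{\,n!}$ is the idempotent power of $\hat\varphi$ in it. $\langle A\mid R\rangle_{\mathsf G}$ denotes the quotient of $\overline\Omega_A\mathsf G$ by the closed congruence generated by $R$. A profinite semigroup $S$ is decidable if there is an algorithm to determine, for a given finite semigroup $T$, whether there is a continuous homomorphism from $S$ onto $T$. *)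

theory Defs
  imports
    "HOL-Algebra.Product_Groups"
    "HOL-Analysis.Analysis"
    "HOL-Library.Nat_Bijection"
begin

section \<open>The free group\<close>

text \<open>The letter \<open>(a, True)\<close> stands for the generator \<open>a\<close>, the letter \<open>(a, False)\<close> for its inverse.
  Elements of the free group are the reduced words.\<close>

type_synonym 'a fword = "('a \<times> bool) list"

definition inv_letter :: "'a \<times> bool \<Rightarrow> 'a \<times> bool" where
  "inv_letter x = (fst x, \<not> snd x)"

definition reduced_words :: "'a set \<Rightarrow> 'a fword set" where
  "reduced_words A = {w \<in> lists (A \<times> UNIV). successively (\<lambda>x y. y \<noteq> inv_letter x) w}"

fun cancel_cons :: "'a \<times> bool \<Rightarrow> 'a fword \<Rightarrow> 'a fword" where
  "cancel_cons x [] = [x]"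
| "cancel_cons x (y # w) = (if y = inv_letter x then w else x # y # w)"

definition free_group :: "'a set \<Rightarrow> 'a fword monoid" where
  "free_group A = \<lparr>carrier = reduced_words A, monoid.mult = (\<lambda>u v. foldr cancel_cons u v), one = []\<rparr>"

lemma inv_letter_inv_letter [simp]: "inv_letter (inv_letter x) = x"
  by (simp add: inv_letter_def)

lemma inv_letter_neq [simp]: "inv_letter x \<noteq> x" "x \<noteq> inv_letter x"
  by (auto simp: inv_letter_def prod_eq_iff)

lemma reduced_words_Nil [simp]: "[] \<in> reduced_words A"
  by (simp add: reduced_words_def)

lemma reduced_words_ConsD:
  "x # w \<in> reduced_words A \<Longrightarrow> fst x \<in> A \<and> w \<in> reduced_words A"
  by (cases w) (auto simp: reduced_words_def)

lemma cancel_cons_reduced: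
  "fst x \<in> A \<Longrightarrow> w \<in> reduced_words A \<Longrightarrow> cancel_cons x w \<in> reduced_words A"
  by (cases w) (auto simp: mem_Times_iff reduced_words_def successively_Cons split: list.splits)

lemma cancel_cons_cancel:
  "w \<in> reduced_words A \<Longrightarrow> cancel_cons x (cancel_cons (inv_letter x) w) = w"
  by (cases w; cases "tl w") (auto simp: reduced_words_def)

lemma foldr_cancel_cons_reduced:
  "u \<in> reduced_words A \<Longrightarrow> v \<in> reduced_words A \<Longrightarrow> foldr cancel_cons u v \<in> reduced_words A"
  by (induction u) (auto dest!: reduced_words_ConsD intro: cancel_cons_reduced)

lemma foldr_cancel_cons_Cons:
  assumes "w \<in> reduced_words A" "v \<in> reduced_words A"
  shows "foldr cancel_cons (cancel_cons x v) w = cancel_cons x (foldr cancel_cons v w)"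
proof (cases v)
  case (Cons y ys)
  then have "foldr cancel_cons ys w \<in> reduced_words A"
    using assms by (auto dest!: reduced_words_ConsD intro: foldr_cancel_cons_reduced)
  then show ?thesis
    using Cons by (auto simp: cancel_cons_cancel)
qed simp

lemma foldr_cancel_cons_assoc:
  assumes "u \<in> reduced_words A" "v \<in> reduced_words A" "w \<in> reduced_words A"
  shows "foldr cancel_cons (foldr cancel_cons u v) w
       = foldr cancel_cons u (foldr cancel_cons v w)"
  using assms(1)
proof (induction u)
  case (Cons x u)
  then show ?case
    using assms reduced_words_ConsD[OF Cons.prems]
    by (simp add: foldr_cancel_cons_Cons[of _ A] foldr_cancel_cons_reduced)
qed simp

lemma foldr_cancel_cons_inverse:
  assumes "u \<in> reduced_words A"
  shows "\<exists>v \<in> reduced_words A. foldr cancel_cons v u = []"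
  using assms
proof (induction u)
  case Nil
  then show ?case by (auto intro: bexI[of _ "[]"])
next
  case (Cons x u)
  have xu: "fst x \<in> A" "u \<in> reduced_words A"
    using reduced_words_ConsD[OF Cons.prems] by auto
  then obtain v where v: "v \<in> reduced_words A" "foldr cancel_cons v u = []"
    using Cons.IH by blast
  have x: "[inv_letter x] \<in> reduced_words A"
    using xu by (cases x) (auto simp: reduced_words_def inv_letter_def)
  have "foldr cancel_cons (foldr cancel_cons v [inv_letter x]) (x # u)
      = foldr cancel_cons v (foldr cancel_cons [inv_letter x] (x # u))"
    using foldr_cancel_cons_assoc v(1) x Cons.prems by blast
  also have "\<dots> = []"
    using v(2) by simp
  finally show ?case
    using foldr_cancel_cons_reduced[OF v(1) x] by blast
qed

lemma group_free_group: "group (free_group A)"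
proof (rule groupI)
  fix u assume "u \<in> carrier (free_group A)"
  then show "\<exists>v \<in> carrier (free_group A). v \<otimes>\<^bsub>free_group A\<^esub> u = \<one>\<^bsub>free_group A\<^esub>"
    using foldr_cancel_cons_inverse by (simp add: free_group_def)
qed (auto simp: free_group_def foldr_cancel_cons_reduced foldr_cancel_cons_assoc)

section \<open>The free profinite group\<close>

definition finite_index_normals :: "('g, 'm) monoid_scheme \<Rightarrow> 'g set set" where
  "finite_index_normals G = {N. N \<lhd> G \<and> finite (carrier (G Mod N))}"

text \<open>The profinite completion: the inverse limit of the finite quotients \<open>G Mod N\<close>.
  For \<open>N \<subseteq> M\<close> the connecting map sends a coset of \<open>N\<close> to the coset of \<open>M\<close> containing it.\<close>

definition profinite_completion :: "('g, 'm) monoid_scheme \<Rightarrow> ('g set \<Rightarrow> 'g set) monoid" where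
  "profinite_completion G =
     (product_group (finite_index_normals G) (\<lambda>N. G Mod N))
       \<lparr>carrier := {x \<in> \<Pi>\<^sub>E N\<in>finite_index_normals G. carrier (G Mod N).
          \<forall>N\<in>finite_index_normals G. \<forall>M\<in>finite_index_normals G. N \<subseteq> M \<longrightarrow> x N \<subseteq> x M}\<rparr>"

definition profinite_completion_top :: "('g, 'm) monoid_scheme \<Rightarrow> ('g set \<Rightarrow> 'g set) topology" where
  "profinite_completion_top G =
     subtopology
       (product_topology (\<lambda>N. discrete_topology (carrier (G Mod N))) (finite_index_normals G))
       (carrier (profinite_completion G))"

definition to_completion :: "('g, 'm) monoid_scheme \<Rightarrow> 'g \<Rightarrow> ('g set \<Rightarrow> 'g set)" where
  "to_completion G g = (\<lambda>N\<in>finite_index_normals G. N #>\<^bsub>G\<^esub> g)"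

text \<open>The finite quotients of the free group on \<open>A\<close> are, up to isomorphism, the finite groups
  generated by an image of \<open>A\<close>. So for a finite set \<open>A\<close> the inverse limit of the \<open>A\<close>-generated
  finite groups, i.e. the free profinite group on \<open>A\<close>, is the profinite completion of the
  free group on \<open>A\<close>.\<close>

type_synonym 'a fprofinite = "'a fword set \<Rightarrow> 'a fword set"

definition free_profinite :: "'a set \<Rightarrow> 'a fprofinite monoid" where
  "free_profinite A = profinite_completion (free_group A)"

definition free_profinite_top :: "'a set \<Rightarrow> 'a fprofinite topology" where
  "free_profinite_top A = profinite_completion_top (free_group A)"

definition free_embed :: "'a set \<Rightarrow> 'a fword \<Rightarrow> 'a fprofinite" where
  "free_embed A = to_completion (free_group A)"

definition free_gen :: "'a set \<Rightarrow> 'a \<Rightarrow> 'a fprofinite" where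
  "free_gen A a = free_embed A [(a, True)]"

section \<open>Continuous endomorphisms and their idempotent powers\<close>

text \<open>Endomorphisms are taken to be \<open>undefined\<close> outside the carrier, so that the extension
  below is unique as a HOL function.\<close>

definition continuous_endos :: "('s, 'm) monoid_scheme \<Rightarrow> 's topology \<Rightarrow> ('s \<Rightarrow> 's) set" where
  "continuous_endos S X = {\<psi> \<in> hom S S. continuous_map X X \<psi> \<and> \<psi> \<in> extensional (carrier S)}"

definition profinite_extension ::
    "'a set \<Rightarrow> ('a fword \<Rightarrow> 'a fword) \<Rightarrow> 'a fprofinite \<Rightarrow> 'a fprofinite" where
  "profinite_extension A \<phi> =
     (THE \<psi>. \<psi> \<in> continuous_endos (free_profinite A) (free_profinite_top A) \<and>
        (\<forall>w \<in> carrier (free_group A). \<psi> (free_embed A w) = free_embed A (\<phi> w)))"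

text \<open>The idempotent power of \<open>\<psi>\<close> in the profinite monoid of continuous endomorphisms, whose
  topology is that of pointwise convergence.\<close>

definition omega_power :: "'s topology \<Rightarrow> ('s \<Rightarrow> 's) \<Rightarrow> 's \<Rightarrow> 's" where
  "omega_power X \<psi> =
     (\<lambda>x\<in>topspace X. THE y. limitin X (\<lambda>n. (\<psi> ^^ fact n) x) y sequentially)"

section \<open>Profinite presentations\<close>

definition closed_congruence ::
    "('s, 'm) monoid_scheme \<Rightarrow> 's topology \<Rightarrow> ('s \<times> 's) set \<Rightarrow> bool" where
  "closed_congruence S X r \<longleftrightarrow>
     equiv (carrier S) r \<and>
     (\<forall>x y u v. (x, y) \<in> r \<longrightarrow> (u, v) \<in> r \<longrightarrow> (x \<otimes>\<^bsub>S\<^esub> u, y \<otimes>\<^bsub>S\<^esub> v) \<in> r) \<and>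
     closedin (prod_topology X X) r"

definition closed_congruence_gen ::
    "('s, 'm) monoid_scheme \<Rightarrow> 's topology \<Rightarrow> ('s \<times> 's) set \<Rightarrow> ('s \<times> 's) set" where
  "closed_congruence_gen S X R = \<Inter>{r. closed_congruence S X r \<and> R \<subseteq> r}"

definition congruence_quotient :: "('s, 'm) monoid_scheme \<Rightarrow> ('s \<times> 's) set \<Rightarrow> 's set monoid" where
  "congruence_quotient S r =
     \<lparr>carrier = carrier S // r,
      monoid.mult = (\<lambda>U V. \<Union>u\<in>U. \<Union>v\<in>V. r `` {u \<otimes>\<^bsub>S\<^esub> v}),
      one = r `` {\<one>\<^bsub>S\<^esub>}\<rparr>"

definition quotient_top :: "'s topology \<Rightarrow> ('s \<times> 's) set \<Rightarrow> 's set topology" where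
  "quotient_top X r = topology (\<lambda>\<U>. \<U> \<subseteq> topspace X // r \<and> openin X (\<Union>\<U>))"

lemma openin_quotient_top:
  assumes "equiv (topspace X) r"
  shows "openin (quotient_top X r) \<U> \<longleftrightarrow> \<U> \<subseteq> topspace X // r \<and> openin X (\<Union>\<U>)"
proof -
  have Un_Int: "\<Union>(\<U> \<inter> \<V>) = \<Union>\<U> \<inter> \<Union>\<V>"
    if "\<U> \<subseteq> topspace X // r" "\<V> \<subseteq> topspace X // r" for \<U> \<V>
  proof
    show "\<Union>\<U> \<inter> \<Union>\<V> \<subseteq> \<Union>(\<U> \<inter> \<V>)"
    proof
      fix x assume "x \<in> \<Union>\<U> \<inter> \<Union>\<V>"
      then obtain U V where "U \<in> \<U>" "V \<in> \<V>" "x \<in> U" "x \<in> V" by blast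
      moreover from this that have "U = V"
        using quotient_disj[OF assms, of U V] by blast
      ultimately show "x \<in> \<Union>(\<U> \<inter> \<V>)" by blast
    qed
  qed blast
  have "istopology (\<lambda>\<U>. \<U> \<subseteq> topspace X // r \<and> openin X (\<Union>\<U>))"
    unfolding istopology_def
  proof (intro conjI allI impI)
    fix \<U> \<V>
    assume "\<U> \<subseteq> topspace X // r \<and> openin X (\<Union>\<U>)" "\<V> \<subseteq> topspace X // r \<and> openin X (\<Union>\<V>)"
    then show "\<U> \<inter> \<V> \<subseteq> topspace X // r" "openin X (\<Union>(\<U> \<inter> \<V>))"
      by (auto simp: Un_Int)
  next
    fix \<K>
    assume \<K>: "\<forall>\<U>\<in>\<K>. \<U> \<subseteq> topspace X // r \<and> openin X (\<Union>\<U>)"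
    then show "\<Union>\<K> \<subseteq> topspace X // r" by blast
    have "\<Union>(\<Union>\<K>) = \<Union>(Union ` \<K>)" by blast
    then show "openin X (\<Union>(\<Union>\<K>))"
      using \<K> by auto
  qed
  then show ?thesis
    by (simp add: quotient_top_def topology_inverse')
qed

definition profinite_presentation ::
    "'a set \<Rightarrow> ('a fprofinite \<times> 'a fprofinite) set \<Rightarrow> 'a fprofinite set monoid" where
  "profinite_presentation A R =
     congruence_quotient (free_profinite A)
       (closed_congruence_gen (free_profinite A) (free_profinite_top A) R)"

definition profinite_presentation_top ::
    "'a set \<Rightarrow> ('a fprofinite \<times> 'a fprofinite) set \<Rightarrow> 'a fprofinite set topology" where
  "profinite_presentation_top A R =
     quotient_top (free_profinite_top A)
       (closed_congruence_gen (free_profinite A) (free_profinite_top A) R)"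

section \<open>Algorithms\<close>

text \<open>Total recursive functions of arity \<open>n\<close>, as functions on argument lists of length \<open>n\<close>: the
  least class containing the initial functions and closed under composition, primitive recursion
  and minimization of regular functions. Values on lists of other lengths are irrelevant, which is
  what the last rule expresses.\<close>

inductive total_recursive :: "nat \<Rightarrow> (nat list \<Rightarrow> nat) \<Rightarrow> bool" where
  zero: "total_recursive n (\<lambda>xs. 0)"
| succ: "total_recursive 1 (\<lambda>xs. Suc (xs ! 0))"
| proj: "i < n \<Longrightarrow> total_recursive n (\<lambda>xs. xs ! i)"
| comp: "total_recursive (length gs) f \<Longrightarrow> (\<And>g. g \<in> set gs \<Longrightarrow> total_recursive n g) \<Longrightarrow>
    total_recursive n (\<lambda>xs. f (map (\<lambda>g. g xs) gs))"
| prec: "total_recursive n f \<Longrightarrow> total_recursive (Suc (Suc n)) g \<Longrightarrow>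
    total_recursive (Suc n)
      (\<lambda>xs. rec_nat (f (tl xs)) (\<lambda>k y. g (k # y # tl xs)) (hd xs))"
| mini: "total_recursive (Suc n) f \<Longrightarrow> (\<And>xs. length xs = n \<Longrightarrow> \<exists>k. f (k # xs) = 0) \<Longrightarrow>
    total_recursive n (\<lambda>xs. LEAST k. f (k # xs) = 0)"
| cong: "total_recursive n f \<Longrightarrow> (\<And>xs. length xs = n \<Longrightarrow> g xs = f xs) \<Longrightarrow> total_recursive n g"

section \<open>Decidable profinite semigroups\<close>

text \<open>A finite semigroup is given by its order \<open>n\<close> and its multiplication table on \<open>{..<n}\<close>,
  listed row by row and coded as a number. The unit of the record is
  meaningless and is not referred to by \<open>hom\<close> and \<open>epi\<close>.\<close>

definition finite_semigroup_table :: "nat \<Rightarrow> (nat \<Rightarrow> nat \<Rightarrow> nat) \<Rightarrow> bool" where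
  "finite_semigroup_table n m \<longleftrightarrow>
     (\<forall>i<n. \<forall>j<n. m i j < n) \<and>
     (\<forall>i<n. \<forall>j<n. \<forall>k<n. m (m i j) k = m i (m j k))"

definition table_semigroup :: "nat \<Rightarrow> (nat \<Rightarrow> nat \<Rightarrow> nat) \<Rightarrow> nat monoid" where
  "table_semigroup n m = \<lparr>carrier = {..<n}, monoid.mult = m, one = undefined\<rparr>"

definition table_code :: "nat \<Rightarrow> (nat \<Rightarrow> nat \<Rightarrow> nat) \<Rightarrow> nat" where
  "table_code n m = list_encode (concat (map (\<lambda>i. map (m i) [0..<n]) [0..<n]))"

definition decidable_profinite :: "('s, 'm) monoid_scheme \<Rightarrow> 's topology \<Rightarrow> bool" where
  "decidable_profinite S X \<longleftrightarrow>
     (\<exists>f. total_recursive 2 f \<and>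
       (\<forall>n m. finite_semigroup_table n m \<longrightarrow>
          f [n, table_code n m] =
            (if \<exists>h \<in> epi S (table_semigroup n m). continuous_map X (discrete_topology {..<n}) h
             then 1 else 0)))"

end

theory Submission
  imports Defs
begin

text \<open>A continuous homomorphism \<open>g\<close> from the free profinite group to a finite group \<open>T\<close> is determined
  by the tuple \<open>t = (g a)\<^sub>a\<close>, and \<open>g \<circ> \<psi>\<close>, with \<open>\<psi>\<close> the extension of \<open>\<phi>\<close>, belongs to the tuple
  \<open>F t = (\<phi>(a) evaluated at t)\<^sub>a\<close>. Since \<open>F\<close> acts on the finite set of tuples, \<open>F^(n!) t\<close> is eventually
  constant, so \<open>g\<close> respects the relations \<open>\<psi>\<^sup>\<omega>(a) = a\<close> if and only if \<open>t\<close> is a periodic point of \<open>F\<close>.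
  Hence \<open>T\<close> is a continuous image of the presented group if and only if it is a group generated by
  a periodic tuple, which is a bounded search.\<close>

section \<open>Closure properties of total recursive functions\<close>

text \<open>Decidability quantifies over finite semigroups, and a table names no unit. As the image
  of a group under a homomorphism is a group, the procedure may search for an identity
  \<open>e\<close> and reject if no choice makes the table a group. \<open>omega_power\<close> is a
  definite description, so nothing can be said about it before the limit is known to exist. Each
  coordinate of the completion is itself a continuous homomorphism to a finite group, so the
  argument that handles one target also gives convergence, coordinate by coordinate. Of the
  exponents \<open>n!\<close> only this matters: they eventually become multiples of any given
  period. The algorithm belongs to one fixed \<phi>: the finitely many words
  \<open>\<phi> [(a, True)]\<close> are built into it as constants. Recursive functions know only
  numbers, so tuples and subsets are coded by digits. Periodicity and generation are both phrased as
  "every closed subset containing these elements contains those", which turns the test into a nest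
  of bounded quantifiers, without programming any orbit or generated subgroup.\<close>

abbreviation recursive_pred :: "nat \<Rightarrow> (nat list \<Rightarrow> bool) \<Rightarrow> bool" where
  "recursive_pred n P \<equiv> total_recursive n (\<lambda>xs. of_bool (P xs))"

text \<open>The rule \<open>comp\<close> yields a composite of one fixed shape. Asking only that
  \<open>h\<close> agree with it on lists of length \<open>n\<close> absorbs the rearrangement, so
  the closure lemmas can be stated for terms as they occur.\<close>

lemma rec_comp:
  assumes "total_recursive m f" "length gs = m" "\<And>g. g \<in> set gs \<Longrightarrow> total_recursive n g"
    and "\<And>xs. length xs = n \<Longrightarrow> h xs = f (map (\<lambda>g. g xs) gs)"
  shows "total_recursive n h"
  using total_recursive.cong[OF total_recursive.comp[of gs f n]] assms by blast

lemma rec_comp1: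
  assumes "total_recursive 1 (\<lambda>xs. f (xs ! 0))" "total_recursive n g"
  shows "total_recursive n (\<lambda>xs. f (g xs))"
  by (rule rec_comp[OF assms(1), of "[g]"]) (use assms in auto)

lemma map_nth_tl:
  "length ys = Suc n \<Longrightarrow> map (\<lambda>i. ys ! Suc i) [0..<n] = tl ys"
  "length ys = Suc (Suc n) \<Longrightarrow> map (\<lambda>i. ys ! Suc (Suc i)) [0..<n] = tl (tl ys)"
  by (auto intro!: nth_equalityI simp: nth_tl)

lemma rec_tl:
  assumes "total_recursive n f"
  shows "total_recursive (Suc n) (\<lambda>ys. f (tl ys))"
  by (rule rec_comp[OF assms, of "map (\<lambda>i xs. xs ! Suc i) [0..<n]"])
     (auto simp: map_nth_tl comp_def intro: total_recursive.proj)

text \<open>Drops argument 1, the accumulator, for a loop body that depends only on the counter and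
  the parameters.\<close>

lemma rec_shift:
  assumes "total_recursive (Suc n) (\<lambda>ys. f (ys ! 0) (tl ys))"
  shows "total_recursive (Suc (Suc n)) (\<lambda>ys. f (ys ! 0) (tl (tl ys)))"
  by (rule rec_comp[OF assms, of "(\<lambda>xs. xs ! 0) # map (\<lambda>i xs. xs ! Suc (Suc i)) [0..<n]"])
     (auto simp: map_nth_tl comp_def intro: total_recursive.proj)

lemma rec_subst:
  assumes "total_recursive (Suc n) (\<lambda>ys. f (ys ! 0) (tl ys))" "total_recursive n b"
  shows "total_recursive n (\<lambda>xs. f (b xs) xs)"
  by (rule rec_comp[OF assms(1), of "b # map (\<lambda>i xs. xs ! i) [0..<n]"])
     (use assms in \<open>auto simp: map_nth comp_def intro: total_recursive.proj\<close>)

text \<open>In the body the counter sits at position 0, the accumulator at 1 and the parameters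
  behind them. \<open>prec\<close> recurses on the first argument; \<open>rec_subst\<close> then
  puts an arbitrary bound \<open>b\<close> there.\<close>

lemma rec_rec_nat:
  assumes "total_recursive n f"
    and "total_recursive (Suc (Suc n)) (\<lambda>ys. g (ys ! 0) (ys ! 1) (tl (tl ys)))"
    and "total_recursive n b"
  shows "total_recursive n (\<lambda>xs. rec_nat (f xs) (\<lambda>k y. g k y xs) (b xs))"
proof -
  have "total_recursive (Suc n) (\<lambda>xs. rec_nat (f (tl xs)) (\<lambda>k y. g k y (tl xs)) (hd xs))"
    using total_recursive.prec[OF assms(1,2)] by simp
  then have "total_recursive (Suc n) (\<lambda>xs. rec_nat (f (tl xs)) (\<lambda>k y. g k y (tl xs)) (xs ! 0))"
    by (rule total_recursive.cong) (auto simp: hd_conv_nth length_Suc_conv)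
  from rec_subst[OF this assms(3)] show ?thesis .
qed

lemma rec_nth [intro]: "i < n \<Longrightarrow> total_recursive n (\<lambda>xs. xs ! i)"
  by (rule total_recursive.proj)

lemma rec_Suc: "total_recursive n f \<Longrightarrow> total_recursive n (\<lambda>xs. Suc (f xs))"
  by (rule rec_comp1[OF total_recursive.succ])

lemma rec_const: "total_recursive n (\<lambda>xs. c)"
  by (induction c) (auto intro: total_recursive.zero rec_Suc)

lemma rec_add:
  assumes "total_recursive n f" "total_recursive n g"
  shows "total_recursive n (\<lambda>xs. f xs + g xs)"
proof -
  have "rec_nat x (\<lambda>k y. Suc y) b = x + b" for x b :: nat
    by (induction b) auto
  moreover have "total_recursive n (\<lambda>xs. rec_nat (f xs) (\<lambda>k y. Suc y) (g xs))"
    by (intro rec_rec_nat assms rec_Suc rec_nth) auto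
  ultimately show ?thesis by simp
qed

lemma rec_mult:
  assumes "total_recursive n f" "total_recursive n g"
  shows "total_recursive n (\<lambda>xs. f xs * g xs)"
proof -
  have "rec_nat 0 (\<lambda>k y. y + x) b = x * b" for x b :: nat
    by (induction b) auto
  moreover have "total_recursive n (\<lambda>xs. rec_nat 0 (\<lambda>k y. y + f xs) (g xs))"
    by (intro rec_rec_nat rec_const assms rec_add rec_nth rec_tl) auto
  ultimately show ?thesis by simp
qed

lemma rec_power:
  assumes "total_recursive n f" "total_recursive n g"
  shows "total_recursive n (\<lambda>xs. f xs ^ g xs)"
proof -
  have "rec_nat 1 (\<lambda>k y. y * x) b = x ^ b" for x b :: nat
    by (induction b) auto
  moreover have "total_recursive n (\<lambda>xs. rec_nat 1 (\<lambda>k y. y * f xs) (g xs))"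
    by (intro rec_rec_nat rec_const assms rec_mult rec_nth rec_tl) auto
  ultimately show ?thesis by simp
qed

lemma rec_diff:
  assumes "total_recursive n f" "total_recursive n g"
  shows "total_recursive n (\<lambda>xs. f xs - g xs)"
proof -
  have pred: "total_recursive m (\<lambda>xs. h xs - 1)" if "total_recursive m h" for m h
  proof -
    \<comment> \<open>The predecessor is the last counter value of the loop; iterating it gives
      truncated subtraction.\<close>
    have "rec_nat 0 (\<lambda>k y. k) b = b - 1" for b :: nat
      by (induction b) auto
    moreover have "total_recursive m (\<lambda>xs. rec_nat 0 (\<lambda>k y. k) (h xs))"
      by (intro rec_rec_nat rec_const that rec_nth) auto
    ultimately show ?thesis by simp
  qed
  have "rec_nat x (\<lambda>k y. y - 1) b = x - b" for x b :: nat
    by (induction b) auto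
  moreover have "total_recursive n (\<lambda>xs. rec_nat (f xs) (\<lambda>k y. y - 1) (g xs))"
    by (intro rec_rec_nat assms pred rec_nth) auto
  ultimately show ?thesis by simp
qed

lemma rec_sum:
  fixes k :: nat
  shows "(\<And>i. i < k \<Longrightarrow> total_recursive n (f i)) \<Longrightarrow> total_recursive n (\<lambda>xs. \<Sum>i<k. f i xs)"
  by (induction k) (auto intro: rec_const rec_add)

lemma rec_not: "recursive_pred n P \<Longrightarrow> recursive_pred n (\<lambda>xs. \<not> P xs)"
  by (rule total_recursive.cong[OF rec_diff[OF rec_const[of _ 1]]]) auto

lemma rec_conj: "recursive_pred n P \<Longrightarrow> recursive_pred n Q \<Longrightarrow> recursive_pred n (\<lambda>xs. P xs \<and> Q xs)"
  using rec_mult[of n "\<lambda>xs. of_bool (P xs)" "\<lambda>xs. of_bool (Q xs)"] by (simp add: of_bool_conj)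

lemma rec_imp: "recursive_pred n P \<Longrightarrow> recursive_pred n Q \<Longrightarrow> recursive_pred n (\<lambda>xs. P xs \<longrightarrow> Q xs)"
  using rec_not[OF rec_conj[OF _ rec_not], of n P Q] by simp

text \<open>Truncated subtraction \<open>f - g\<close> is 0 exactly if the inequality holds, so
  \<open>1 - (f - g)\<close> is its truth value.\<close>

lemma rec_le:
  assumes "total_recursive n f" "total_recursive n g"
  shows "recursive_pred n (\<lambda>xs. f xs \<le> g xs)"
  by (rule total_recursive.cong[OF rec_diff[OF rec_const[of _ 1] rec_diff[OF assms]]]) auto

lemma rec_less:
  assumes "total_recursive n f" "total_recursive n g"
  shows "recursive_pred n (\<lambda>xs. f xs < g xs)"
  using rec_le[OF rec_Suc[OF assms(1)] assms(2)] by (simp add: Suc_le_eq)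

lemma rec_eq:
  assumes "total_recursive n f" "total_recursive n g"
  shows "recursive_pred n (\<lambda>xs. f xs = g xs)"
  using rec_conj[OF rec_le[OF assms] rec_le[OF assms(2,1)]] by (simp add: order_antisym_conv order_eq_iff)

text \<open>A bounded quantifier is the product of the truth values over its range, computed by
  primitive recursion.\<close>

lemma rec_all_less:
  assumes "total_recursive n b" "recursive_pred (Suc n) (\<lambda>ys. P (ys ! 0) (tl ys))"
  shows "recursive_pred n (\<lambda>xs. \<forall>k<b xs. P k xs)"
proof -
  have "rec_nat 1 (\<lambda>k y. y * of_bool (Q k)) m = (of_bool (\<forall>k<m. Q k) :: nat)" for Q m
    by (induction m) (auto simp: less_Suc_eq)
  moreover have "total_recursive n (\<lambda>xs. rec_nat 1 (\<lambda>k y. y * of_bool (P k xs)) (b xs))"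
    by (intro rec_rec_nat rec_const assms rec_mult rec_nth rec_shift[of n "\<lambda>k xs. of_bool (P k xs)"]) auto
  ultimately show ?thesis by simp
qed

lemma rec_ex_less:
  assumes "total_recursive n b" "recursive_pred (Suc n) (\<lambda>ys. P (ys ! 0) (tl ys))"
  shows "recursive_pred n (\<lambda>xs. \<exists>k<b xs. P k xs)"
  using rec_not[OF rec_all_less[OF assms(1) rec_not[OF assms(2)]]] by simp

text \<open>\<open>mini\<close> looks for a zero, hence the negated predicate in the proof; the
  second assumption is the regularity that it demands.\<close>

lemma rec_Least:
  assumes "recursive_pred (Suc n) (\<lambda>ys. P (ys ! 0) (tl ys))"
    and "\<And>xs. length xs = n \<Longrightarrow> \<exists>k. P k xs"
  shows "total_recursive n (\<lambda>xs. LEAST k. P k xs)"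
  by (rule total_recursive.cong[OF total_recursive.mini[OF rec_not[OF assms(1)]]]) (use assms(2) in auto)

lemmas rec_intros = rec_nth rec_Suc rec_const rec_add rec_mult rec_power rec_diff rec_not rec_conj rec_imp
  rec_le rec_less rec_eq rec_all_less rec_ex_less

section \<open>Division, pairing and decoding of lists\<close>

lemma rec_div:
  assumes "total_recursive n f" "total_recursive n g"
  shows "total_recursive n (\<lambda>xs. f xs div g xs)"
proof -
  \<comment> \<open>The quotient is the least \<open>q\<close> with \<open>x < Suc q * y\<close>.
    For \<open>y = 0\<close> the guard lets the search succeed at 0, in agreement with
    \<open>x div 0 = 0\<close>.\<close>
  have ub: "0 < y \<longrightarrow> x < Suc (x div y) * y" for x y :: nat
    using dividend_less_times_div[of y x] by (simp add: mult.commute)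
  have eq: "x div y = (LEAST q. 0 < y \<longrightarrow> x < Suc q * y)" for x y :: nat
  proof (rule Least_equality[symmetric])
    show "0 < y \<longrightarrow> x < Suc (x div y) * y" by (rule ub)
    show "x div y \<le> q" if "0 < y \<longrightarrow> x < Suc q * y" for q
      using that by (cases "y = 0") (simp_all add: div_less_iff_less_mult flip: less_Suc_eq_le)
  qed
  have "\<exists>q. 0 < y \<longrightarrow> x < Suc q * y" for x y :: nat
    using ub by blast
  then show ?thesis
    unfolding eq by (intro rec_Least rec_intros rec_tl assms) auto
qed

lemma rec_mod:
  assumes "total_recursive n f" "total_recursive n g"
  shows "total_recursive n (\<lambda>xs. f xs mod g xs)"
  unfolding modulo_nat_def by (intro rec_intros rec_div assms)

text \<open>Doubling the triangular number in \<open>prod_encode\<close> removes the division and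
  leaves a polynomial equation for the code \<open>z\<close>. Both coordinates are at most
  \<open>z\<close>, so each is found by a minimization in which the other one is bounded by
  \<open>Suc z\<close>.\<close>

lemma rec_fst_decode:
  assumes "total_recursive n f"
  shows "total_recursive n (\<lambda>xs. fst (prod_decode (f xs)))"
    and rec_snd_decode: "total_recursive n (\<lambda>xs. snd (prod_decode (f xs)))"
proof -
  have enc: "z = prod_encode (x, y) \<longleftrightarrow> 2 * z = (x + y) * Suc (x + y) + 2 * x" for x y z
  proof -
    have "2 * triangle m = m * Suc m" for m
      by (induction m) auto
    then have "2 * prod_encode (x, y) = (x + y) * Suc (x + y) + 2 * x"
      by (simp add: prod_encode_def)
    then show ?thesis by linarith
  qed
  have "fst (prod_decode z) = (LEAST x. \<exists>y<Suc z. 2 * z = (x + y) * Suc (x + y) + 2 * x)"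
    "snd (prod_decode z) = (LEAST y. \<exists>x<Suc z. 2 * z = (x + y) * Suc (x + y) + 2 * x)"
    "\<exists>x. \<exists>y<Suc z. 2 * z = (x + y) * Suc (x + y) + 2 * x"
    "\<exists>y. \<exists>x<Suc z. 2 * z = (x + y) * Suc (x + y) + 2 * x" for z
  proof -
    obtain x y where z: "z = prod_encode (x, y)"
      by (metis prod_decode_inverse surj_pair)
    have xy: "x < Suc z" "y < Suc z"
      unfolding z by (simp_all add: less_Suc_eq_le le_prod_encode_1 le_prod_encode_2)
    show "fst (prod_decode z) = (LEAST x. \<exists>y<Suc z. 2 * z = (x + y) * Suc (x + y) + 2 * x)"
      "snd (prod_decode z) = (LEAST y. \<exists>x<Suc z. 2 * z = (x + y) * Suc (x + y) + 2 * x)"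
      unfolding enc[symmetric] using xy
      by (auto intro!: Least_equality[symmetric] simp: z)
    show "\<exists>x. \<exists>y<Suc z. 2 * z = (x + y) * Suc (x + y) + 2 * x"
      "\<exists>y. \<exists>x<Suc z. 2 * z = (x + y) * Suc (x + y) + 2 * x"
      unfolding enc[symmetric] using xy z by blast+
  qed
  note eq = this
  show "total_recursive n (\<lambda>xs. fst (prod_decode (f xs)))"
    unfolding eq(1) by (rule rec_Least[OF _ eq(3)], intro rec_intros rec_tl assms) auto
  show "total_recursive n (\<lambda>xs. snd (prod_decode (f xs)))"
    unfolding eq(2) by (rule rec_Least[OF _ eq(4)], intro rec_intros rec_tl assms) auto
qed

text \<open>\<open>list_encode\<close> maps a nonempty list to the successor of the pair of its head
  and its coded tail. Hence the decrement before each decoding; every \<open>snd\<close> drops one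
  entry.\<close>

definition code_nth :: "nat \<Rightarrow> nat \<Rightarrow> nat" where
  "code_nth c i = fst (prod_decode (rec_nat c (\<lambda>_ d. snd (prod_decode (d - 1))) i - 1))"

lemma code_nth_list_encode:
  "i < length xs \<Longrightarrow> code_nth (list_encode xs) i = xs ! i"
proof -
  have "rec_nat (list_encode xs) (\<lambda>_ d. snd (prod_decode (d - 1))) i = list_encode (drop i xs)"
    if "i \<le> length xs" for i
    using that
  proof (induction i)
    case (Suc i)
    then show ?case by (simp flip: Cons_nth_drop_Suc)
  qed simp
  then show "i < length xs \<Longrightarrow> ?thesis"
    by (simp add: code_nth_def flip: Cons_nth_drop_Suc)
qed

lemma rec_code_nth:
  assumes "total_recursive n f" "total_recursive n g"
  shows "total_recursive n (\<lambda>xs. code_nth (f xs) (g xs))"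
  unfolding code_nth_def by (intro rec_intros rec_fst_decode rec_snd_decode rec_rec_nat assms) auto

section \<open>Digits in a given base\<close>

definition digit :: "nat \<Rightarrow> nat \<Rightarrow> nat \<Rightarrow> nat" where
  "digit b i z = z div b ^ i mod b"

lemma rec_digit:
  assumes "total_recursive n f" "total_recursive n g" "total_recursive n h"
  shows "total_recursive n (\<lambda>xs. digit (f xs) (g xs) (h xs))"
  unfolding digit_def by (intro rec_intros rec_div rec_mod assms)

lemma digit_less: "0 < b \<Longrightarrow> digit b i z < b"
  by (simp add: digit_def)

text \<open>The induction removes the lowest digit: division by \<open>b\<close> shifts the
  sequence, which is why \<open>f\<close> and \<open>i\<close> are kept arbitrary.\<close>

lemma digit_sum:
  assumes "\<And>j. j < k \<Longrightarrow> f j < b" "i < k"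
  shows "digit b i (\<Sum>j<k. f j * b ^ j) = f i"
  using assms
proof (induction k arbitrary: f i)
  case (Suc k)
  let ?S = "\<Sum>j<k. f (Suc j) * b ^ j"
  have S: "(\<Sum>j<Suc k. f j * b ^ j) = f 0 + b * ?S"
    by (simp add: sum.lessThan_Suc_shift sum_distrib_left algebra_simps del: sum.lessThan_Suc)
  have f0: "f 0 < b" using Suc.prems by auto
  show ?case
  proof (cases i)
    case 0
    then show ?thesis using f0 unfolding S by (simp add: digit_def)
  next
    case (Suc j)
    have "digit b (Suc j) (f 0 + b * ?S) = digit b j ?S"
      using f0 by (simp add: digit_def div_mult2_eq)
    then show ?thesis
      using Suc Suc.IH[of "\<lambda>j. f (Suc j)" j] Suc.prems unfolding S by simp
  qed
qed simp

lemma sum_digits_less: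
  "(\<And>j. j < k \<Longrightarrow> f j < (b::nat)) \<Longrightarrow> (\<Sum>j<k. f j * b ^ j) < b ^ k"
proof (induction k)
  case (Suc k)
  then have "(\<Sum>j<Suc k. f j * b ^ j) < b ^ k + f k * b ^ k" by simp
  also have "\<dots> = Suc (f k) * b ^ k" by simp
  also have "\<dots> \<le> b * b ^ k" using Suc.prems[of k] by (intro mult_le_mono1) auto
  finally show ?case by simp
qed simp

section \<open>Profinite completions\<close>

context group
begin

lemma rcos_Int:
  assumes "N \<subseteq> carrier G" "M \<subseteq> carrier G" "g \<in> carrier G"
  shows "(N \<inter> M) #> g = (N #> g) \<inter> (M #> g)"
proof -
  have "inj_on (\<lambda>h. h \<otimes> g) (carrier G)"
    using assms by (auto intro: inj_onI)
  then have "(\<lambda>h. h \<otimes> g) ` (N \<inter> M) = (\<lambda>h. h \<otimes> g) ` N \<inter> (\<lambda>h. h \<otimes> g) ` M"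
    using assms by (intro inj_on_image_Int) auto
  then show ?thesis by (auto simp: r_coset_def)
qed

text \<open>A coset of \<open>N \<inter> M\<close> is the intersection of a coset of
  \<open>N\<close> with a coset of \<open>M\<close>, and there are finitely many such pairs.\<close>

lemma finite_index_normals_Int:
  assumes "N \<in> finite_index_normals G" "M \<in> finite_index_normals G"
  shows "N \<inter> M \<in> finite_index_normals G"
proof -
  have sub: "N \<subseteq> carrier G" "M \<subseteq> carrier G"
    using assms by (auto simp: finite_index_normals_def dest: normal_imp_subgroup subgroup.subset)
  have "carrier (G Mod (N \<inter> M)) \<subseteq> (\<lambda>(X, Y). X \<inter> Y) ` (carrier (G Mod N) \<times> carrier (G Mod M))"
    using sub by (auto simp: carrier_FactGroup rcos_Int)
  then have "finite (carrier (G Mod (N \<inter> M)))"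
    by (rule finite_subset) (use assms in \<open>auto simp: finite_index_normals_def\<close>)
  then show ?thesis
    using assms normal_subgroup_intersect by (auto simp: finite_index_normals_def)
qed

lemma carrier_finite_index_normals: "carrier G \<in> finite_index_normals G"
proof -
  have "carrier (G Mod carrier G) \<subseteq> {carrier G}"
    using coset_join2[OF _ subgroup_self] by (auto simp: carrier_FactGroup)
  then show ?thesis
    by (auto simp: finite_index_normals_def intro: normal_invI subgroup_self finite_subset)
qed

text \<open>A basic open set of the product restricts finitely many coordinates; a single
  \<open>N\<close> below all of them controls it.\<close>

lemma finite_index_normals_lower_bound:
  assumes "finite W" "W \<subseteq> finite_index_normals G"
  shows "\<exists>N\<in>finite_index_normals G. \<forall>M\<in>W. N \<subseteq> M"
  using assms
proof (induction W)
  case empty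
  then show ?case using carrier_finite_index_normals by blast
next
  case (insert M W)
  then obtain N where "N \<in> finite_index_normals G" "\<forall>K\<in>W. N \<subseteq> K" by blast
  then show ?case
    using insert.prems finite_index_normals_Int[of N M] by (intro bexI[of _ "N \<inter> M"]) auto
qed

section \<open>The completion as a topological group\<close>

abbreviation "pc \<equiv> profinite_completion G"
abbreviation "pc_top \<equiv> profinite_completion_top G"

lemma carrier_completion:
  "carrier pc = {x \<in> \<Pi>\<^sub>E N\<in>finite_index_normals G. carrier (G Mod N).
     \<forall>N\<in>finite_index_normals G. \<forall>M\<in>finite_index_normals G. N \<subseteq> M \<longrightarrow> x N \<subseteq> x M}"
  by (simp add: profinite_completion_def)

lemma mult_completion: "x \<otimes>\<^bsub>pc\<^esub> y = (\<lambda>N\<in>finite_index_normals G. x N <#> y N)"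
  by (simp add: profinite_completion_def)

lemma normal_of_finite_index: "N \<in> finite_index_normals G \<Longrightarrow> N \<lhd> G"
  by (simp add: finite_index_normals_def)

text \<open>It is a subgroup of the product of the quotients: products and inverses of cosets are
  formed elementwise and so preserve the inclusions \<open>x N \<subseteq> x M\<close>.\<close>

lemma group_completion: "group pc"
proof -
  let ?P = "product_group (finite_index_normals G) (\<lambda>N. G Mod N)"
  have grp: "group (G Mod N)" if "N \<in> finite_index_normals G" for N
    using normal.factorgroup_is_group[OF normal_of_finite_index[OF that]] .
  then interpret P: group ?P by auto
  have "subgroup (carrier pc) ?P"
  proof (rule P.subgroupI)
    show "carrier pc \<subseteq> carrier ?P"
      by (auto simp: carrier_completion)
    have "\<one>\<^bsub>?P\<^esub> \<in> carrier pc"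
      using grp P.one_closed by (auto simp: carrier_completion)
    then show "carrier pc \<noteq> {}" by blast
  next
    fix x assume x: "x \<in> carrier pc"
    then have xP: "x \<in> carrier ?P" by (auto simp: carrier_completion)
    then have inv: "(inv\<^bsub>?P\<^esub> x) N = set_inv (x N)" if "N \<in> finite_index_normals G" for N
      using that normal.inv_FactGroup[OF normal_of_finite_index[OF that]] grp
      by (auto simp: inv_product_group PiE_iff)
    have "inv\<^bsub>?P\<^esub> x \<in> carrier ?P" using xP by (rule P.inv_closed)
    then show "inv\<^bsub>?P\<^esub> x \<in> carrier pc"
      using x by (auto simp: carrier_completion inv SET_INV_def subset_eq simp del: inv_product_group)
  next
    fix x y assume x: "x \<in> carrier pc" and y: "y \<in> carrier pc"
    then have "x \<in> carrier ?P" "y \<in> carrier ?P" by (auto simp: carrier_completion)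
    then have "x \<otimes>\<^bsub>?P\<^esub> y \<in> carrier ?P" by (rule P.m_closed)
    moreover have "(x \<otimes>\<^bsub>?P\<^esub> y) N \<subseteq> (x \<otimes>\<^bsub>?P\<^esub> y) M"
      if "N \<in> finite_index_normals G" "M \<in> finite_index_normals G" "N \<subseteq> M" for N M
    proof -
      have "x N \<subseteq> x M" "y N \<subseteq> y M" using x y that by (auto simp: carrier_completion)
      then show ?thesis using that by (auto simp: set_mult_def)
    qed
    ultimately show "x \<otimes>\<^bsub>?P\<^esub> y \<in> carrier pc"
      by (simp add: carrier_completion)
  qed
  from subgroup.subgroup_is_group[OF this P.is_group] show ?thesis
    by (simp add: profinite_completion_def)
qed

text \<open>Any element of the coset \<open>x N\<close> represents it, which lets later proofs
  compute with elements of \<open>G\<close> in place of cosets.\<close>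

lemma completion_memD:
  assumes "x \<in> carrier pc" "N \<in> finite_index_normals G"
  shows "x N \<in> carrier (G Mod N)" "w \<in> x N \<Longrightarrow> w \<in> carrier G \<and> x N = N #> w" "\<exists>w. w \<in> x N"
    "M \<in> finite_index_normals G \<Longrightarrow> N \<subseteq> M \<Longrightarrow> x N \<subseteq> x M"
proof -
  show xN: "x N \<in> carrier (G Mod N)"
    using assms by (auto simp: carrier_completion PiE_iff)
  have sub: "subgroup N G" using assms(2) normal_of_finite_index normal_imp_subgroup by blast
  obtain g where g: "g \<in> carrier G" "x N = N #> g"
    using xN by (auto simp: carrier_FactGroup)
  show "w \<in> carrier G \<and> x N = N #> w" if "w \<in> x N"
    using that g repr_independence[OF _ g(1) sub] r_coset_subset_G[OF subgroup.subset[OF sub] g(1)]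
    by auto
  show "\<exists>w. w \<in> x N" using g rcos_self[OF _ sub] by auto
  show "x N \<subseteq> x M" if "M \<in> finite_index_normals G" "N \<subseteq> M"
    using assms that by (auto simp: carrier_completion)
qed

lemma topspace_completion: "topspace pc_top = carrier pc"
  by (auto simp: profinite_completion_top_def carrier_completion)

lemma Hausdorff_completion: "Hausdorff_space pc_top"
  by (simp add: profinite_completion_top_def Hausdorff_space_subtopology Hausdorff_space_product_topology)

lemma to_completion_mem:
  assumes "g \<in> carrier G" shows "to_completion G g \<in> carrier pc"
  using assms by (auto simp: carrier_completion to_completion_def carrier_FactGroup r_coset_def)

lemma to_completion_mult:
  "g \<in> carrier G \<Longrightarrow> h \<in> carrier G \<Longrightarrow>
    to_completion G (g \<otimes> h) = to_completion G g \<otimes>\<^bsub>pc\<^esub> to_completion G h"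
  by (auto simp: mult_completion to_completion_def normal.rcos_sum[OF normal_of_finite_index]
      intro!: restrict_ext)

text \<open>For a basic neighbourhood of \<open>x\<close>, take \<open>N\<close> contained in all
  the subgroups whose coordinates are restricted. Any element of \<open>x N\<close> then represents
  \<open>x\<close> at every one of these coordinates.\<close>

lemma dense_to_completion:
  "pc_top closure_of (to_completion G ` carrier G) = carrier pc"
proof -
  let ?I = "finite_index_normals G"
  have "\<exists>g\<in>carrier G. to_completion G g \<in> T" if "x \<in> T" "openin pc_top T" for x T
  proof -
    obtain T' where T': "openin (product_topology (\<lambda>N. discrete_topology (carrier (G Mod N))) ?I) T'"
      "T = T' \<inter> carrier pc"
      using \<open>openin pc_top T\<close> by (auto simp: profinite_completion_top_def openin_subtopology)
    then have x: "x \<in> carrier pc" "x \<in> T'" using that(1) by auto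
    then obtain U where U: "finite {N \<in> ?I. U N \<noteq> carrier (G Mod N)}" "x \<in> Pi\<^sub>E ?I U" "Pi\<^sub>E ?I U \<subseteq> T'"
      using T'(1) unfolding openin_product_topology_alt by auto
    obtain N where N: "N \<in> ?I" "\<And>M. M \<in> ?I \<Longrightarrow> U M \<noteq> carrier (G Mod M) \<Longrightarrow> N \<subseteq> M"
      using finite_index_normals_lower_bound[OF U(1)] by auto
    obtain g where g: "g \<in> x N" using completion_memD(3)[OF x(1) N(1)] by blast
    then have gG: "g \<in> carrier G" using completion_memD(2)[OF x(1) N(1)] by blast
    have "M #> g \<in> U M" if M: "M \<in> ?I" for M
    proof (cases "U M = carrier (G Mod M)")
      case True
      then show ?thesis using gG by (auto simp: carrier_FactGroup)
    next
      case False
      then have "g \<in> x M" using completion_memD(4)[OF x(1) N(1) M] N(2)[OF M] g by blast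
      then have "x M = M #> g" using completion_memD(2)[OF x(1) M] by blast
      then show ?thesis using U(2) M by (auto simp: PiE_iff)
    qed
    then have "to_completion G g \<in> T'"
      using U(3) by (auto simp: to_completion_def PiE_iff)
    then show ?thesis using gG T'(2) to_completion_mem by blast
  qed
  then show ?thesis
    by (auto simp: in_closure_of topspace_completion)
qed

lemma continuous_maps_completion_eqI:
  assumes "continuous_map pc_top Y f" "continuous_map pc_top Y f'" "Hausdorff_space Y"
    and "\<And>g. g \<in> carrier G \<Longrightarrow> f (to_completion G g) = f' (to_completion G g)"
    and "x \<in> carrier pc"
  shows "f x = f' x"
  using forall_in_closure_of_eq[OF _ assms(3,1,2), of x "to_completion G ` carrier G"] assms(4,5)
  by (auto simp: dense_to_completion)

text \<open>A homomorphism \<open>f\<close> is constant on cosets of its kernel, so the set under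
  \<open>the_elem\<close> is a singleton and the extension reads off one coordinate of
  \<open>x\<close>.\<close>

definition completion_lift :: "('c, 'd) monoid_scheme \<Rightarrow> ('a \<Rightarrow> 'c) \<Rightarrow> ('a set \<Rightarrow> 'a set) \<Rightarrow> 'c" where
  "completion_lift H f x = the_elem (f ` x (kernel G H f))"

context
  fixes H :: "('c, 'd) monoid_scheme" and f
  assumes H: "group H" "finite (carrier H)" and f: "f \<in> hom G H"
begin

lemma kernel_finite_index: "kernel G H f \<in> finite_index_normals G"
proof -
  interpret I: group_hom G H f
    using H f by (simp add: group_hom_def group_hom_axioms_def)
  have "(\<lambda>X. the_elem (f ` X)) ` carrier (G Mod kernel G H f) \<subseteq> carrier H"
    using I.FactGroup_the_elem_mem by blast
  then have "finite (carrier (G Mod kernel G H f))"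
    using inj_on_finite[OF I.FactGroup_inj_on _ H(2)] by blast
  then show ?thesis using I.normal_kernel by (simp add: finite_index_normals_def)
qed

text \<open>Allowing any \<open>N\<close> inside the kernel lets one representative compute the
  lifts of two homomorphisms, by passing to the intersection of their kernels.\<close>

lemma completion_lift_eq:
  assumes "x \<in> carrier pc" "N \<in> finite_index_normals G" "N \<subseteq> kernel G H f" "w \<in> x N"
  shows "completion_lift H f x = f w"
proof -
  interpret I: group_hom G H f
    using H f by (simp add: group_hom_def group_hom_axioms_def)
  have w: "w \<in> x (kernel G H f)"
    using completion_memD(4)[OF assms(1,2) kernel_finite_index assms(3)] assms(4) by blast
  then have "w \<in> carrier G" "x (kernel G H f) = kernel G H f #> w"
    using completion_memD(2)[OF assms(1) kernel_finite_index] by auto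
  then have "f ` x (kernel G H f) \<subseteq> {f w}"
    by (auto simp: r_coset_def kernel_def)
  then have "f ` x (kernel G H f) = {f w}" using w by blast
  then show ?thesis by (simp add: completion_lift_def)
qed

lemma completion_lift_to_completion:
  assumes "g \<in> carrier G" shows "completion_lift H f (to_completion G g) = f g"
proof (rule completion_lift_eq[OF to_completion_mem[OF assms] kernel_finite_index order_refl])
  show "g \<in> to_completion G g (kernel G H f)"
    using rcos_self[OF assms normal_imp_subgroup[OF normal_of_finite_index[OF kernel_finite_index]]]
      kernel_finite_index
    by (simp add: to_completion_def)
qed

lemma completion_lift_hom: "completion_lift H f \<in> hom pc H"
proof -
  interpret I: group_hom G H f
    using H f by (simp add: group_hom_def group_hom_axioms_def)
  let ?K = "kernel G H f"
  interpret C: group pc by (rule group_completion)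
  have eq: "completion_lift H f x = f w" if "x \<in> carrier pc" "w \<in> x ?K" for x w
    using completion_lift_eq[OF that(1) kernel_finite_index order_refl that(2)] .
  show ?thesis
  proof (rule homI)
    fix x assume x: "x \<in> carrier pc"
    obtain w where w: "w \<in> x ?K" using completion_memD(3)[OF x kernel_finite_index] by blast
    then show "completion_lift H f x \<in> carrier H"
      using eq[OF x w] completion_memD(2)[OF x kernel_finite_index] by auto
  next
    fix x y assume x: "x \<in> carrier pc" and y: "y \<in> carrier pc"
    obtain v w where v: "v \<in> x ?K" and w: "w \<in> y ?K"
      using completion_memD(3)[OF _ kernel_finite_index] x y by meson
    have "v \<otimes> w \<in> (x \<otimes>\<^bsub>pc\<^esub> y) ?K"
      using v w kernel_finite_index by (auto simp: mult_completion set_mult_def)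
    moreover have "v \<in> carrier G" "w \<in> carrier G"
      using v w x y completion_memD(2)[OF _ kernel_finite_index] by auto
    ultimately show "completion_lift H f (x \<otimes>\<^bsub>pc\<^esub> y)
        = completion_lift H f x \<otimes>\<^bsub>H\<^esub> completion_lift H f y"
      using eq[OF x v] eq[OF y w] eq[OF C.m_closed[OF x y]] by simp
  qed
qed

text \<open>The lift factors through the projection to a single coordinate, which is a discrete
  space.\<close>

lemma continuous_completion_lift:
  "continuous_map pc_top (discrete_topology (carrier H)) (completion_lift H f)"
proof -
  let ?K = "kernel G H f"
  have "continuous_map pc_top (discrete_topology (carrier (G Mod ?K))) (\<lambda>x. x ?K)"
    unfolding profinite_completion_top_def
    by (intro continuous_map_from_subtopology continuous_map_product_projection kernel_finite_index)
  moreover have "continuous_map (discrete_topology (carrier (G Mod ?K))) (discrete_topology (carrier H))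
      (\<lambda>X. the_elem (f ` X))"
  proof -
    interpret I: group_hom G H f
      using H f by (simp add: group_hom_def group_hom_axioms_def)
    show ?thesis using I.FactGroup_the_elem_mem by auto
  qed
  ultimately have "continuous_map pc_top (discrete_topology (carrier H))
      ((\<lambda>X. the_elem (f ` X)) \<circ> (\<lambda>x. x ?K))"
    by (rule continuous_map_compose)
  then show ?thesis by (simp add: comp_def completion_lift_def[abs_def])
qed

end

text \<open>The coordinate of the image at \<open>N\<close> is the lift of
  \<open>w \<mapsto> N #> \<phi> w\<close>, a homomorphism to a finite group.\<close>

lemma endo_extension_exists:
  assumes \<phi>: "\<phi> \<in> hom G G"
  obtains \<psi> where "\<psi> \<in> continuous_endos pc pc_top"
    "\<And>g. g \<in> carrier G \<Longrightarrow> \<psi> (to_completion G g) = to_completion G (\<phi> g)"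
proof -
  let ?I = "finite_index_normals G"
  let ?f = "\<lambda>N w. N #> \<phi> w"
  define \<psi>0 where "\<psi>0 x = (\<lambda>N\<in>?I. completion_lift (G Mod N) (?f N) x)" for x
  interpret C: group pc by (rule group_completion)
  have N: "group (G Mod N)" "finite (carrier (G Mod N))" "?f N \<in> hom G (G Mod N)" if "N \<in> ?I" for N
  proof -
    show "group (G Mod N)" "finite (carrier (G Mod N))"
      using that by (auto simp: finite_index_normals_def normal.factorgroup_is_group)
    show "?f N \<in> hom G (G Mod N)"
      using \<phi> normal.r_coset_hom_Mod[OF normal_of_finite_index[OF that]]
      by (auto simp: hom_def Pi_iff)
  qed
  have \<phi>G: "\<phi> w \<in> carrier G" if "w \<in> carrier G" for w using \<phi> that by (rule hom_in_carrier)
  have mem: "\<psi>0 x \<in> carrier pc" if x: "x \<in> carrier pc" for x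
  proof -
    have "\<psi>0 x N \<subseteq> \<psi>0 x M" if NM: "N \<in> ?I" "M \<in> ?I" "N \<subseteq> M" for N M
    proof -
      let ?KN = "kernel G (G Mod N) (?f N)" and ?KM = "kernel G (G Mod M) (?f M)"
      note KN = kernel_finite_index[OF N[OF NM(1)]] and KM = kernel_finite_index[OF N[OF NM(2)]]
      \<comment> \<open>A representative of \<open>x\<close> at the common refinement
        \<open>?L\<close> computes both coordinates, which reduces compatibility to
        \<open>N \<subseteq> M\<close>.\<close>
      let ?L = "?KN \<inter> ?KM"
      have L: "?L \<in> ?I" using KN KM by (rule finite_index_normals_Int)
      obtain w where w: "w \<in> x ?L" using completion_memD(3)[OF x L] by blast
      have "\<psi>0 x N = N #> \<phi> w" "\<psi>0 x M = M #> \<phi> w"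
        using NM completion_lift_eq[OF N[OF NM(1)] x L _ w] completion_lift_eq[OF N[OF NM(2)] x L _ w]
        by (auto simp: \<psi>0_def)
      then show ?thesis using NM(3) by (auto simp: r_coset_def)
    qed
    then show ?thesis
      using hom_in_carrier[OF completion_lift_hom[OF N] x]
      by (auto simp: carrier_completion \<psi>0_def)
  qed
  have hom: "\<psi>0 (x \<otimes>\<^bsub>pc\<^esub> y) = \<psi>0 x \<otimes>\<^bsub>pc\<^esub> \<psi>0 y"
    if "x \<in> carrier pc" "y \<in> carrier pc" for x y
    unfolding mult_completion[of "\<psi>0 x"] unfolding \<psi>0_def
    by (rule restrict_ext) (simp add: hom_mult[OF completion_lift_hom[OF N] that])
  have cont: "continuous_map pc_top pc_top \<psi>0"
  proof -
    have "continuous_map pc_top (product_topology (\<lambda>N. discrete_topology (carrier (G Mod N))) ?I) \<psi>0"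
      unfolding continuous_map_componentwise
      by (auto simp: \<psi>0_def N intro!: continuous_completion_lift)
    then show ?thesis
      unfolding profinite_completion_top_def[of G] continuous_map_in_subtopology
      using mem by (auto simp flip: profinite_completion_top_def simp: topspace_completion)
  qed
  have ext: "\<psi>0 (to_completion G g) = to_completion G (\<phi> g)" if "g \<in> carrier G" for g
    unfolding \<psi>0_def to_completion_def[of G "\<phi> g"]
    by (rule restrict_ext) (rule completion_lift_to_completion[OF N that])
  show ?thesis
  proof (rule that[of "restrict \<psi>0 (carrier pc)"])
    show "restrict \<psi>0 (carrier pc) \<in> continuous_endos pc pc_top"
      using mem hom cont unfolding continuous_endos_def hom_def
      by (auto intro: continuous_map_eq[OF cont] simp: topspace_completion C.m_closed)
  qed (use ext to_completion_mem in auto)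
qed

end

section \<open>Evaluation of words\<close>

context group
begin

definition letter_val :: "('x \<Rightarrow> 'a) \<Rightarrow> 'x \<times> bool \<Rightarrow> 'a" where
  "letter_val t x = (if snd x then t (fst x) else inv (t (fst x)))"

definition word_val :: "('x \<Rightarrow> 'a) \<Rightarrow> 'x fword \<Rightarrow> 'a" where
  "word_val t w = foldr (\<lambda>x y. letter_val t x \<otimes> y) w \<one>"

lemma word_val_simps [simp]:
  "word_val t [] = \<one>"
  "word_val t (x # w) = letter_val t x \<otimes> word_val t w"
  by (simp_all add: word_val_def)

lemma letter_val_closed: "t \<in> B \<rightarrow> carrier G \<Longrightarrow> fst x \<in> B \<Longrightarrow> letter_val t x \<in> carrier G"
  by (auto simp: letter_val_def)

lemma word_val_closed: "t \<in> B \<rightarrow> carrier G \<Longrightarrow> w \<in> reduced_words B \<Longrightarrow> word_val t w \<in> carrier G"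
  by (induction w) (auto dest!: reduced_words_ConsD intro!: letter_val_closed)

lemma word_val_cong:
  assumes "\<And>a. a \<in> B \<Longrightarrow> t a = t' a" "w \<in> reduced_words B"
  shows "word_val t w = word_val t' w"
  using assms(2) by (induction w) (auto dest!: reduced_words_ConsD simp: letter_val_def assms(1))

text \<open>Cancelling a letter against its inverse does not change the value, so the product of
  reduced words can be evaluated letter by letter.\<close>

lemma word_val_cancel_cons:
  assumes "t \<in> B \<rightarrow> carrier G" "fst x \<in> B" "w \<in> reduced_words B"
  shows "word_val t (cancel_cons x w) = letter_val t x \<otimes> word_val t w"
proof (cases w)
  case (Cons y v)
  have v: "word_val t v \<in> carrier G"
    using assms Cons word_val_closed by (auto dest!: reduced_words_ConsD)
  have "letter_val t x \<otimes> (letter_val t (inv_letter x) \<otimes> word_val t v) = word_val t v"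
  proof -
    have "t (fst x) \<in> carrier G" using assms by auto
    then have "letter_val t x \<otimes> letter_val t (inv_letter x) = \<one>"
      "letter_val t x \<in> carrier G" "letter_val t (inv_letter x) \<in> carrier G"
      by (simp_all add: letter_val_def inv_letter_def)
    then show ?thesis using v by (simp flip: m_assoc)
  qed
  then show ?thesis using Cons by auto
qed simp

lemma word_val_hom:
  assumes t: "t \<in> B \<rightarrow> carrier G"
  shows "word_val t \<in> hom (free_group B) G"
proof (rule homI)
  fix u v assume "u \<in> carrier (free_group B)" and v: "v \<in> carrier (free_group B)"
  then show "word_val t (u \<otimes>\<^bsub>free_group B\<^esub> v) = word_val t u \<otimes> word_val t v"
  proof (induction u)
    case (Cons x u)
    then have x: "fst x \<in> B" and u: "u \<in> reduced_words B" and v: "v \<in> reduced_words B"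
      by (auto simp: free_group_def dest!: reduced_words_ConsD)
    then show ?case
      using Cons.IH word_val_cancel_cons[OF t x foldr_cancel_cons_reduced[OF u v]]
        word_val_closed[OF t] letter_val_closed[OF t x]
      by (simp add: free_group_def m_assoc)
  qed (use word_val_closed[OF t] in \<open>auto simp: free_group_def\<close>)
qed (use word_val_closed[OF t] in \<open>auto simp: free_group_def\<close>)

lemma hom_free_group_eq_word_val:
  assumes f: "f \<in> hom (free_group B) G" and w: "w \<in> carrier (free_group B)"
  shows "f w = word_val (\<lambda>a. f [(a, True)]) w"
proof -
  interpret F: group_hom "free_group B" G f
    using f group_free_group is_group by (simp add: group_hom_def group_hom_axioms_def)
  have letter: "[x] \<in> carrier (free_group B)" if "fst x \<in> B" for x
    using that by (cases x) (auto simp: free_group_def reduced_words_def)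
  have fx: "f [x] = letter_val (\<lambda>a. f [(a, True)]) x" if x: "fst x \<in> B" for x
  proof (cases "snd x")
    case False
    have "[x] \<otimes>\<^bsub>free_group B\<^esub> [inv_letter x] = \<one>\<^bsub>free_group B\<^esub>"
      by (simp add: free_group_def)
    then have "f [x] \<otimes> f [inv_letter x] = \<one>"
      using letter[of x] letter[of "inv_letter x"] x F.hom_mult F.hom_one
      by (metis fst_conv inv_letter_def)
    then have "f [x] = inv (f [inv_letter x])"
      using letter[of x] letter[of "inv_letter x"] x
      by (intro inv_equality[symmetric]) (auto simp: inv_letter_def)
    then show ?thesis using False by (simp add: letter_val_def inv_letter_def)
  qed (use x in \<open>simp add: letter_val_def flip: surjective_pairing; metis prod.collapse\<close>)
  show ?thesis using w
  proof (induction w)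
    case Nil
    then show ?case using F.hom_one by (simp add: free_group_def)
  next
    case (Cons x w)
    then have x: "fst x \<in> B" "w \<in> carrier (free_group B)"
      by (auto simp: free_group_def dest!: reduced_words_ConsD)
    \<comment> \<open>As \<open>x # w\<close> is reduced, no cancellation occurs in this
      product.\<close>
    have "x # w = [x] \<otimes>\<^bsub>free_group B\<^esub> w"
      using Cons.prems by (cases w) (auto simp: free_group_def reduced_words_def)
    then have "f (x # w) = f [x] \<otimes> f w"
      using letter[of x] x by simp
    then show ?case using Cons.IH x fx by simp
  qed
qed

text \<open>Left multiplication by \<open>x\<close> is injective on the finite set \<open>S\<close>,
  hence onto, and so it hits the identity. Generation of a finite group can therefore be tested with
  products alone.\<close>

lemma finite_mult_closed_inv:
  assumes "finite S" "S \<subseteq> carrier G" "\<And>x y. x \<in> S \<Longrightarrow> y \<in> S \<Longrightarrow> x \<otimes> y \<in> S" "\<one> \<in> S" "x \<in> S"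
  shows "inv x \<in> S"
proof -
  have "inj_on ((\<otimes>) x) S" using assms by (intro inj_onI) (metis Units_eq Units_l_cancel subsetD)
  then have "(\<otimes>) x ` S = S"
    using assms by (intro endo_inj_surj) auto
  then obtain y where "y \<in> S" "x \<otimes> y = \<one>"
    using assms(4) by (metis imageE)
  then show ?thesis using assms inv_unique' by (metis inv_equality inv_inv subsetD)
qed

end

section \<open>Iteration on finite sets\<close>

lemma funpow_closed: "f \<in> X \<rightarrow> X \<Longrightarrow> x \<in> X \<Longrightarrow> (f ^^ n) x \<in> X"
  by (induction n) auto

lemma funpow_add_apply: "(f ^^ (m + n)) x = (f ^^ m) ((f ^^ n) x)"
  by (simp add: funpow_add)

lemma funpow_period_mult:
  fixes f :: "'a \<Rightarrow> 'a"
  shows "(f ^^ p) x = x \<Longrightarrow> (f ^^ (k * p)) x = x"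
  by (induction k) (auto simp: funpow_add)

text \<open>By the pigeonhole principle the orbit is periodic with some period \<open>p\<close>
  after \<open>i\<close> steps. For \<open>n \<ge> i + p\<close> the exponent \<open>n!\<close> is
  past these steps, and \<open>(n+1)! - n! = n * n!\<close> is a multiple of
  \<open>p\<close>.\<close>

lemma funpow_fact_eventually_const:
  assumes "finite X" "f \<in> X \<rightarrow> X" "x \<in> X"
  shows "\<exists>y. \<forall>\<^sub>F n in sequentially. (f ^^ fact n) x = y"
proof -
  have "\<not> inj (\<lambda>n. (f ^^ n) x)"
  proof
    assume "inj (\<lambda>n. (f ^^ n) x)"
    moreover have "range (\<lambda>n. (f ^^ n) x) \<subseteq> X" using funpow_closed[OF assms(2,3)] by auto
    ultimately show False using assms(1) by (meson finite_imageD finite_subset infinite_UNIV_nat)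
  qed
  then obtain i j where ij: "i < j" "(f ^^ i) x = (f ^^ j) x"
    by (metis injI linorder_neqE_nat)
  define p where "p = j - i"
  have "(f ^^ p) ((f ^^ i) x) = (f ^^ (p + i)) x" by (simp add: funpow_add)
  then have p: "0 < p" "(f ^^ p) ((f ^^ i) x) = (f ^^ i) x"
    using ij by (simp_all add: p_def)
  have "(f ^^ fact (Suc n)) x = (f ^^ fact n) x" if n: "n \<ge> i + p" for n
  proof -
    have "p dvd fact n" using p n by (auto intro: dvd_fact)
    then obtain k where k: "n * fact n = k * p" by (metis dvd_mult dvd_mult_div_cancel mult.commute)
    have i: "fact n = fact n - i + i" using n fact_ge_self[of n] by linarith
    have "(f ^^ fact (Suc n)) x = (f ^^ (fact n - i + (k * p + i))) x"
      using i by (simp add: add.commute flip: k)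
    also have "\<dots> = (f ^^ (fact n - i)) ((f ^^ i) x)"
      unfolding funpow_add_apply using funpow_period_mult[OF p(2)] by simp
    also have "\<dots> = (f ^^ fact n) x"
      using i by (metis funpow_add_apply)
    finally show ?thesis .
  qed
  then have "(f ^^ fact (i + p + n)) x = (f ^^ fact (i + p)) x" for n
    by (induction n) auto
  then show ?thesis
    by (intro exI[of _ "(f ^^ fact (i + p)) x"] eventually_sequentiallyI[of "i + p"]) (metis le_Suc_ex)
qed

text \<open>A factorial is itself a positive period; conversely a period \<open>p\<close> divides
  \<open>n!\<close> for all \<open>n \<ge> p\<close>.\<close>

lemma funpow_fact_eventually_fixed_iff:
  fixes f :: "'a \<Rightarrow> 'a"
  shows "(\<forall>\<^sub>F n in sequentially. (f ^^ fact n) x = x) \<longleftrightarrow> (\<exists>p>0. (f ^^ p) x = x)"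
proof
  assume "\<forall>\<^sub>F n in sequentially. (f ^^ fact n) x = x"
  then obtain n where "(f ^^ fact n) x = x"
    by (auto simp: eventually_sequentially)
  then show "\<exists>p>0. (f ^^ p) x = x" using fact_gt_zero by blast
next
  assume "\<exists>p>0. (f ^^ p) x = x"
  then obtain p where p: "p > 0" "(f ^^ p) x = x" by blast
  show "\<forall>\<^sub>F n in sequentially. (f ^^ fact n) x = x"
  proof (rule eventually_sequentiallyI[of p])
    fix n assume "p \<le> n"
    then have "p dvd fact n" using p by (auto intro: dvd_fact)
    then show "(f ^^ fact n) x = x"
      using funpow_period_mult[OF p(2)] by (metis dvd_def mult.commute)
  qed
qed

section \<open>Quotients by closed congruences\<close>

lemma closed_congruence_gen_equiv:
  assumes "topspace X = carrier S" "\<And>x y. x \<in> carrier S \<Longrightarrow> y \<in> carrier S \<Longrightarrow> x \<otimes>\<^bsub>S\<^esub> y \<in> carrier S"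
    "R \<subseteq> carrier S \<times> carrier S"
  shows "equiv (carrier S) (closed_congruence_gen S X R)"
    and closed_congruence_gen_mult: "\<And>x y u v. (x, y) \<in> closed_congruence_gen S X R \<Longrightarrow>
      (u, v) \<in> closed_congruence_gen S X R \<Longrightarrow> (x \<otimes>\<^bsub>S\<^esub> u, y \<otimes>\<^bsub>S\<^esub> v) \<in> closed_congruence_gen S X R"
proof -
  let ?C = "{r. closed_congruence S X r \<and> R \<subseteq> r}"
  \<comment> \<open>The total relation belongs to the family because of the assumption on
    \<open>R\<close>, so the intersection is not over an empty family.\<close>
  have all: "carrier S \<times> carrier S \<in> ?C"
    using assms closedin_topspace[of "prod_topology X X"]
    by (auto simp: closed_congruence_def equiv_def refl_on_def sym_def trans_def)
  have eq: "equiv (carrier S) r" if "r \<in> ?C" for r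
    using that by (simp add: closed_congruence_def)
  show "equiv (carrier S) (closed_congruence_gen S X R)"
    unfolding closed_congruence_gen_def
  proof (rule equivI)
    show "\<Inter>?C \<subseteq> carrier S \<times> carrier S" using all by (rule Inter_lower)
    show "refl_on (carrier S) (\<Inter>?C)"
      using eq by (intro refl_onI InterI) (meson equivE refl_onD)
    show "sym (\<Inter>?C)"
      using eq by (intro symI InterI) (meson InterD equivE symD)
    show "trans (\<Inter>?C)"
      using eq by (intro transI InterI) (meson InterD equivE transD)
  qed
  show "(x \<otimes>\<^bsub>S\<^esub> u, y \<otimes>\<^bsub>S\<^esub> v) \<in> closed_congruence_gen S X R"
    if "(x, y) \<in> closed_congruence_gen S X R" "(u, v) \<in> closed_congruence_gen S X R" for x y u v
    using that unfolding closed_congruence_gen_def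
    by (intro InterI) (auto simp: closed_congruence_def)
qed

text \<open>The kernel is the equalizer of two continuous maps into a Hausdorff space, hence
  closed.\<close>

lemma closed_congruence_kernel:
  assumes "topspace X = carrier S" "\<And>x y. x \<in> carrier S \<Longrightarrow> y \<in> carrier S \<Longrightarrow> x \<otimes>\<^bsub>S\<^esub> y \<in> carrier S"
    and "g \<in> hom S T" "continuous_map X Y g" "Hausdorff_space Y"
  shows "closed_congruence S X {(x, y) \<in> carrier S \<times> carrier S. g x = g y}"
proof -
  have "closedin (prod_topology X X) {z \<in> topspace (prod_topology X X). (g \<circ> fst) z = (g \<circ> snd) z}"
    by (intro closedin_continuous_maps_eq[OF assms(5)] continuous_map_compose[OF _ assms(4)]
        continuous_map_fst continuous_map_snd)
  also have "{z \<in> topspace (prod_topology X X). (g \<circ> fst) z = (g \<circ> snd) z}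
      = {(x, y) \<in> carrier S \<times> carrier S. g x = g y}"
    using assms(1) by auto
  finally show ?thesis
    using assms(2) hom_mult[OF assms(3)]
    by (auto simp: closed_congruence_def equiv_def refl_on_def sym_def trans_def)
qed

text \<open>The universal property of the presentation. One direction composes with the quotient
  map; in the other, \<open>g\<close> factors since \<open>r\<close>, the least closed congruence
  containing \<open>R\<close>, lies in the kernel of \<open>g\<close>. No group structure is asked
  of \<open>T\<close>, as it will also be the semigroup of a table.\<close>

lemma epi_presentation_iff:
  assumes top: "topspace X = carrier S"
    and closed: "\<And>x y. x \<in> carrier S \<Longrightarrow> y \<in> carrier S \<Longrightarrow> x \<otimes>\<^bsub>S\<^esub> y \<in> carrier S"
    and R: "R \<subseteq> carrier S \<times> carrier S"
  defines "r \<equiv> closed_congruence_gen S X R"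
  shows "(\<exists>h \<in> epi (congruence_quotient S r) T.
            continuous_map (quotient_top X r) (discrete_topology (carrier T)) h) \<longleftrightarrow>
         (\<exists>g \<in> epi S T. continuous_map X (discrete_topology (carrier T)) g \<and> (\<forall>(u, v)\<in>R. g u = g v))"
    (is "?L \<longleftrightarrow> ?R")
proof -
  let ?Q = "congruence_quotient S r"
  have equiv: "equiv (carrier S) r"
    unfolding r_def by (rule closed_congruence_gen_equiv[OF top closed R])
  have mult_r: "(x \<otimes>\<^bsub>S\<^esub> u, y \<otimes>\<^bsub>S\<^esub> v) \<in> r" if "(x, y) \<in> r" "(u, v) \<in> r" for x y u v
    using closed_congruence_gen_mult[OF top closed R] that by (simp add: r_def)
  have R_r: "R \<subseteq> r" by (auto simp: r_def closed_congruence_gen_def)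
  have carrier_Q: "carrier ?Q = carrier S // r" by (simp add: congruence_quotient_def)
  have cls: "r `` {x} \<in> carrier ?Q" if "x \<in> carrier S" for x
    using that by (simp add: carrier_Q quotientI)
  have mult_Q: "r `` {x} \<otimes>\<^bsub>?Q\<^esub> r `` {y} = r `` {x \<otimes>\<^bsub>S\<^esub> y}"
    if x: "x \<in> carrier S" and y: "y \<in> carrier S" for x y
  proof -
    have "(\<Union>u\<in>r `` {x}. \<Union>v\<in>r `` {y}. r `` {u \<otimes>\<^bsub>S\<^esub> v})
        = (\<Union>u\<in>r `` {x}. \<Union>v\<in>r `` {y}. r `` {x \<otimes>\<^bsub>S\<^esub> y})"
      using equiv_class_eq[OF equiv mult_r] by (intro SUP_cong refl) simp
    also have "\<dots> = r `` {x \<otimes>\<^bsub>S\<^esub> y}"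
      using equiv_class_self[OF equiv x] equiv_class_self[OF equiv y] by blast
    finally show ?thesis by (simp add: congruence_quotient_def)
  qed
  have opQ: "openin (quotient_top X r) U \<longleftrightarrow> U \<subseteq> carrier S // r \<and> openin X (\<Union>U)" for U
    by (rule openin_quotient_top[of X r, unfolded top, OF equiv])
  have topQ: "topspace (quotient_top X r) = carrier S // r"
  proof -
    have "openin (quotient_top X r) (carrier S // r)"
      unfolding opQ Union_quotient[OF equiv] using openin_topspace[of X] top by simp
    moreover have "topspace (quotient_top X r) \<subseteq> carrier S // r"
      using openin_topspace[of "quotient_top X r"] unfolding opQ by (rule conjunct1)
    ultimately show ?thesis using openin_subset by (intro antisym) auto
  qed
  \<comment> \<open>A set of classes corresponds to a saturated subset of \<open>S\<close>. This
    converts openness in the quotient topology into openness in \<open>X\<close>, in both directions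
    of the proof.\<close>
  have preimage: "\<Union>{U \<in> carrier S // r. h U \<in> V} = {x \<in> carrier S. h (r `` {x}) \<in> V}" for h :: "'a set \<Rightarrow> 'c" and V
  proof -
    have "x \<in> U \<longleftrightarrow> x \<in> carrier S \<and> r `` {x} = U" if U: "U \<in> carrier S // r" for x U
    proof -
      obtain y where y: "U = r `` {y}" "y \<in> carrier S" using U by (auto elim: quotientE)
      then show ?thesis using equiv_class_eq_iff[OF equiv, of y x] by auto
    qed
    then show ?thesis by (auto intro: quotientI)
  qed
  show ?thesis
  proof
    assume ?L
    then obtain h where h: "h \<in> epi ?Q T"
      and cont: "continuous_map (quotient_top X r) (discrete_topology (carrier T)) h" by blast
    define g where "g x = h (r `` {x})" for x
    have hom: "h \<in> hom ?Q T" and img: "h ` carrier ?Q = carrier T" using h by (auto simp: epi_def)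
    have "g \<in> hom S T"
      using hom_in_carrier[OF hom cls] hom_mult[OF hom cls cls]
      by (intro homI) (auto simp: g_def mult_Q)
    moreover have "g ` carrier S = carrier T"
      unfolding img[symmetric] carrier_Q by (auto simp: g_def quotient_def)
    moreover have "continuous_map X (discrete_topology (carrier T)) g"
      unfolding continuous_map_def
    proof (intro conjI allI impI)
      show "g \<in> topspace X \<rightarrow> topspace (discrete_topology (carrier T))"
        using hom_in_carrier[OF hom cls] by (auto simp: g_def top)
      fix V assume "openin (discrete_topology (carrier T)) V"
      then have "openin (quotient_top X r) {U \<in> topspace (quotient_top X r). h U \<in> V}"
        using cont openin_continuous_map_preimage by blast
      then show "openin X {x \<in> topspace X. g x \<in> V}"
        unfolding opQ topQ preimage by (simp add: g_def top)
    qed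
    moreover have "\<forall>(u, v)\<in>R. g u = g v"
      using equiv_class_eq[OF equiv] R_r by (auto simp: g_def)
    ultimately show ?R by (auto simp: epi_def)
  next
    assume ?R
    then obtain g where g: "g \<in> epi S T"
      and cont: "continuous_map X (discrete_topology (carrier T)) g"
      and gR: "\<forall>(u, v)\<in>R. g u = g v" by blast
    have hom: "g \<in> hom S T" and img: "g ` carrier S = carrier T" using g by (auto simp: epi_def)
    have "r \<subseteq> {(x, y) \<in> carrier S \<times> carrier S. g x = g y}"
      unfolding r_def closed_congruence_gen_def
      by (rule Inter_lower, rule CollectI, rule conjI, rule closed_congruence_kernel[OF top closed hom cont])
         (use gR R in auto)
    then have g_r: "g x = g y" if "(x, y) \<in> r" for x y using that by auto
    define h where "h U = g (SOME u. u \<in> U)" for U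
    have h: "h (r `` {x}) = g x" if "x \<in> carrier S" for x
    proof -
      have "(SOME u. u \<in> r `` {x}) \<in> r `` {x}"
        using equiv_class_self[OF equiv that] by (rule someI)
      then show ?thesis using g_r[of x] by (simp add: h_def)
    qed
    have reps: "(\<forall>U\<in>carrier S // r. P U) \<longleftrightarrow> (\<forall>x\<in>carrier S. P (r `` {x}))" for P
      by (auto simp: quotient_def)
    have "h \<in> hom ?Q T"
      unfolding hom_def carrier_Q Pi_iff reps mem_Collect_eq
      using hom_in_carrier[OF hom] hom_mult[OF hom] by (simp add: h mult_Q closed)
    moreover have "h ` carrier ?Q = carrier T"
      unfolding carrier_Q img[symmetric] quotient_def by (auto simp: h image_iff)
    moreover have "continuous_map (quotient_top X r) (discrete_topology (carrier T)) h"
      unfolding continuous_map_def topQ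
    proof (intro conjI allI impI)
      show "h \<in> carrier S // r \<rightarrow> topspace (discrete_topology (carrier T))"
        unfolding Pi_iff reps using hom_in_carrier[OF hom] by (simp add: h)
      fix V assume "openin (discrete_topology (carrier T)) V"
      then have "openin X {x \<in> topspace X. g x \<in> V}"
        using cont openin_continuous_map_preimage by blast
      also have "{x \<in> topspace X. g x \<in> V} = {x \<in> carrier S. h (r `` {x}) \<in> V}"
        by (auto simp: h top)
      finally show "openin (quotient_top X r) {U \<in> carrier S // r. h U \<in> V}"
        unfolding opQ preimage by auto
    qed
    ultimately show ?L by (auto simp: epi_def)
  qed
qed

section \<open>Continuous homomorphisms from the free profinite group to finite groups\<close>

locale free_group_endo =
  fixes A :: "'a set" and \<phi> :: "'a fword \<Rightarrow> 'a fword"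
  assumes finite_A: "finite A" and \<phi>_hom: "\<phi> \<in> hom (free_group A) (free_group A)"
begin

sublocale F: group "free_group A" by (rule group_free_group)

sublocale \<Omega>: group "free_profinite A"
  unfolding free_profinite_def by (rule F.group_completion)

abbreviation "\<psi> \<equiv> profinite_extension A \<phi>"
abbreviation "\<omega> \<equiv> omega_power (free_profinite_top A) \<psi>"

lemma topspace_free_profinite: "topspace (free_profinite_top A) = carrier (free_profinite A)"
  by (simp add: free_profinite_def free_profinite_top_def F.topspace_completion)

lemma Hausdorff_free_profinite: "Hausdorff_space (free_profinite_top A)"
  by (simp add: free_profinite_top_def F.Hausdorff_completion)

lemma free_embed_mem: "w \<in> carrier (free_group A) \<Longrightarrow> free_embed A w \<in> carrier (free_profinite A)"
  by (simp add: free_embed_def free_profinite_def F.to_completion_mem)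

lemma letter_mem: "fst x \<in> A \<Longrightarrow> [x] \<in> carrier (free_group A)"
  by (cases x) (auto simp: free_group_def reduced_words_def)

lemma free_gen_mem: "a \<in> A \<Longrightarrow> free_gen A a \<in> carrier (free_profinite A)"
  by (simp add: free_gen_def free_embed_mem letter_mem)

lemma free_embed_hom: "free_embed A \<in> hom (free_group A) (free_profinite A)"
  using free_embed_mem F.to_completion_mult
  by (auto intro!: homI simp: free_embed_def free_profinite_def)

text \<open>This resolves the definite description: two candidates agree on the dense free group,
  hence on the whole carrier, and outside it both are \<open>undefined\<close>.\<close>

lemma profinite_extension:
  "\<psi> \<in> continuous_endos (free_profinite A) (free_profinite_top A)"
  "w \<in> carrier (free_group A) \<Longrightarrow> \<psi> (free_embed A w) = free_embed A (\<phi> w)"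
proof -
  let ?P = "\<lambda>\<psi>. \<psi> \<in> continuous_endos (free_profinite A) (free_profinite_top A) \<and>
    (\<forall>w \<in> carrier (free_group A). \<psi> (free_embed A w) = free_embed A (\<phi> w))"
  obtain \<psi>' where \<psi>': "?P \<psi>'"
    using F.endo_extension_exists[OF \<phi>_hom]
    unfolding free_profinite_def free_profinite_top_def free_embed_def by metis
  have "\<psi>1 = \<psi>'" if \<psi>1: "?P \<psi>1" for \<psi>1
  proof (rule extensionalityI)
    show "\<psi>1 \<in> extensional (carrier (free_profinite A))" "\<psi>' \<in> extensional (carrier (free_profinite A))"
      using \<psi>1 \<psi>' by (auto simp: continuous_endos_def)
    fix x assume "x \<in> carrier (free_profinite A)"
    then show "\<psi>1 x = \<psi>' x"
      using \<psi>1 \<psi>' F.continuous_maps_completion_eqI[OF _ _ Hausdorff_free_profinite, of \<psi>1 \<psi>' x]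
      by (auto simp: continuous_endos_def free_profinite_def free_profinite_top_def free_embed_def)
  qed
  with \<psi>' have "\<exists>!\<psi>. ?P \<psi>" by blast
  from theI'[OF this]
  show "\<psi> \<in> continuous_endos (free_profinite A) (free_profinite_top A)"
    "w \<in> carrier (free_group A) \<Longrightarrow> \<psi> (free_embed A w) = free_embed A (\<phi> w)"
    unfolding profinite_extension_def by blast+
qed

lemma \<psi>_hom: "\<psi> \<in> hom (free_profinite A) (free_profinite A)"
  and \<psi>_continuous: "continuous_map (free_profinite_top A) (free_profinite_top A) \<psi>"
  using profinite_extension(1) by (auto simp: continuous_endos_def)

lemma \<psi>_iterate_mem: "x \<in> carrier (free_profinite A) \<Longrightarrow> (\<psi> ^^ n) x \<in> carrier (free_profinite A)"
  using hom_in_carrier[OF \<psi>_hom] by (induction n) auto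

section \<open>Continuous homomorphisms and their tuples of values\<close>

definition cont_hom :: "('c, 'd) monoid_scheme \<Rightarrow> ('a fprofinite \<Rightarrow> 'c) \<Rightarrow> bool" where
  "cont_hom T g \<longleftrightarrow> g \<in> hom (free_profinite A) T \<and>
     continuous_map (free_profinite_top A) (discrete_topology (carrier T)) g"

definition gen_vals :: "('a fprofinite \<Rightarrow> 'c) \<Rightarrow> 'a \<Rightarrow> 'c" where
  "gen_vals g = (\<lambda>a\<in>A. g (free_gen A a))"

lemma gen_vals_eq_iff: "gen_vals f = gen_vals g \<longleftrightarrow> (\<forall>a\<in>A. f (free_gen A a) = g (free_gen A a))"
proof
  assume eq: "gen_vals f = gen_vals g"
  show "\<forall>a\<in>A. f (free_gen A a) = g (free_gen A a)"
    using fun_cong[OF eq] by (metis gen_vals_def restrict_apply')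
qed (auto simp: gen_vals_def)

text \<open>The map \<open>F\<close> of the overview. Tuples are \<open>undefined\<close> off
  \<open>A\<close>, so that equality of tuples is equality of functions.\<close>

definition transfer :: "('c, 'd) monoid_scheme \<Rightarrow> ('a \<Rightarrow> 'c) \<Rightarrow> 'a \<Rightarrow> 'c" where
  "transfer T t = (\<lambda>a\<in>A. group.word_val T t (\<phi> [(a, True)]))"

lemma cont_hom_comp_\<psi>: "cont_hom T g \<Longrightarrow> cont_hom T (\<lambda>x. g ((\<psi> ^^ n) x))"
proof (induction n)
  case (Suc n)
  then have *: "cont_hom T (\<lambda>x. g ((\<psi> ^^ n) x))" by simp
  have "cont_hom T ((\<lambda>x. g ((\<psi> ^^ n) x)) \<circ> \<psi>)"
    using * \<psi>_hom continuous_map_compose[OF \<psi>_continuous]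
    unfolding cont_hom_def by (auto simp: hom_def Pi_iff)
  then show ?case by (simp add: comp_def funpow_swap1)
qed simp

context
  fixes T :: "('c, 'd) monoid_scheme"
  assumes T: "group T" and finite_T: "finite (carrier T)"
begin

interpretation T: group T by (rule T)

lemma gen_vals_mem: "cont_hom T g \<Longrightarrow> gen_vals g \<in> A \<rightarrow>\<^sub>E carrier T"
  using hom_in_carrier[OF _ free_gen_mem] by (fastforce simp: cont_hom_def gen_vals_def)

lemma cont_hom_free_embed:
  assumes g: "cont_hom T g" and w: "w \<in> carrier (free_group A)"
  shows "g (free_embed A w) = T.word_val (gen_vals g) w"
proof -
  have "(\<lambda>w. g (free_embed A w)) \<in> hom (free_group A) T"
    using g free_embed_hom unfolding cont_hom_def by (auto simp: hom_def Pi_iff)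
  then have "g (free_embed A w) = T.word_val (\<lambda>a. g (free_gen A a)) w"
    using T.hom_free_group_eq_word_val[OF _ w] by (simp add: free_gen_def)
  also have "\<dots> = T.word_val (gen_vals g) w"
    using w by (intro T.word_val_cong[of A]) (auto simp: gen_vals_def free_group_def)
  finally show ?thesis .
qed

lemma cont_hom_eqI:
  assumes "cont_hom T g" "cont_hom T g'" "gen_vals g = gen_vals g'" "x \<in> carrier (free_profinite A)"
  shows "g x = g' x"
proof (rule F.continuous_maps_completion_eqI[where Y = "discrete_topology (carrier T)" and f = g and f' = g'])
  show "continuous_map F.pc_top (discrete_topology (carrier T)) g"
    "continuous_map F.pc_top (discrete_topology (carrier T)) g'" "x \<in> carrier F.pc"
    using assms by (simp_all add: cont_hom_def free_profinite_top_def free_profinite_def)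
  show "g (to_completion (free_group A) w) = g' (to_completion (free_group A) w)"
    if "w \<in> carrier (free_group A)" for w
    using cont_hom_free_embed[OF assms(1) that] cont_hom_free_embed[OF assms(2) that] assms(3)
    by (simp add: free_embed_def)
qed simp

lemma gen_vals_comp_\<psi>:
  assumes g: "cont_hom T g"
  shows "gen_vals (\<lambda>x. g (\<psi> x)) = transfer T (gen_vals g)"
proof
  fix a
  show "gen_vals (\<lambda>x. g (\<psi> x)) a = transfer T (gen_vals g) a"
    using cont_hom_free_embed[OF g] profinite_extension(2) hom_in_carrier[OF \<phi>_hom] letter_mem
    by (auto simp: gen_vals_def[of "\<lambda>x. g (\<psi> x)"] transfer_def free_gen_def)
qed

lemma gen_vals_iterate:
  assumes g: "cont_hom T g"
  shows "gen_vals (\<lambda>x. g ((\<psi> ^^ n) x)) = (transfer T ^^ n) (gen_vals g)"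
proof (induction n)
  case (Suc n)
  then show ?case
    using gen_vals_comp_\<psi>[OF cont_hom_comp_\<psi>[OF g, of n]] by (simp add: funpow_swap1)
qed simp

lemma transfer_mem: "t \<in> A \<rightarrow>\<^sub>E carrier T \<Longrightarrow> transfer T t \<in> A \<rightarrow>\<^sub>E carrier T"
  using hom_in_carrier[OF \<phi>_hom letter_mem] T.word_val_closed[of t A]
  by (auto simp: transfer_def free_group_def PiE_iff Pi_iff)

text \<open>The tuples of \<open>g\<close> composed with \<open>\<psi> ^^ fact n\<close> are
  eventually constant, and a tuple determines the homomorphism; hence one threshold serves all
  \<open>x\<close>.\<close>

lemma cont_hom_fact_iterate_eventually_const:
  assumes g: "cont_hom T g"
  shows "\<exists>y. \<forall>\<^sub>F n in sequentially. \<forall>x\<in>carrier (free_profinite A). g ((\<psi> ^^ fact n) x) = y x"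
proof -
  have fin: "finite (A \<rightarrow>\<^sub>E carrier T)" using finite_A finite_T by (rule finite_PiE)
  have "transfer T \<in> (A \<rightarrow>\<^sub>E carrier T) \<rightarrow> (A \<rightarrow>\<^sub>E carrier T)"
    using transfer_mem by (rule funcsetI)
  from funpow_fact_eventually_const[OF fin this gen_vals_mem[OF g]]
  obtain t where "\<forall>\<^sub>F n in sequentially. (transfer T ^^ fact n) (gen_vals g) = t" ..
  then obtain m where m: "\<And>n. n \<ge> m \<Longrightarrow> (transfer T ^^ fact n) (gen_vals g) = t"
    unfolding eventually_sequentially by meson
  show ?thesis
  proof (rule exI, rule eventually_sequentiallyI, rule ballI)
    fix n x assume "m \<le> n" "x \<in> carrier (free_profinite A)"
    then show "g ((\<psi> ^^ fact n) x) = g ((\<psi> ^^ fact m) x)"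
      using m[of n] m[of m] cont_hom_eqI[OF cont_hom_comp_\<psi>[OF g] cont_hom_comp_\<psi>[OF g]]
      by (simp add: gen_vals_iterate[OF g])
  qed
qed

text \<open>The universal property: evaluation of words at \<open>t\<close> is lifted to the
  completion.\<close>

lemma cont_hom_exists:
  assumes t: "t \<in> A \<rightarrow>\<^sub>E carrier T"
  obtains g where "cont_hom T g" "gen_vals g = t"
proof -
  have t': "t \<in> A \<rightarrow> carrier T" using t by auto
  note f = T.word_val_hom[OF t']
  let ?g = "F.completion_lift T (T.word_val t)"
  have "cont_hom T ?g"
    using F.completion_lift_hom[OF T finite_T f] F.continuous_completion_lift[OF T finite_T f]
    by (simp add: cont_hom_def free_profinite_def free_profinite_top_def)
  moreover have "gen_vals ?g = t"
  proof
    fix a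
    have "?g (free_gen A a) = t a" if "a \<in> A"
      using F.completion_lift_to_completion[OF T finite_T f letter_mem[of "(a, True)"]] funcset_mem[OF t' that] that
      by (simp add: free_gen_def free_embed_def T.letter_val_def)
    then show "gen_vals ?g a = t a" using t by (auto simp: gen_vals_def)
  qed
  ultimately show ?thesis by (rule that)
qed

text \<open>The fibres of \<open>g\<close> over its values are open and meet the dense free group,
  so the image of \<open>g\<close> consists of the values of words. Submonoids of a finite group are
  closed under inverses, whence the condition speaks of products only; this is the form that the
  decision procedure tests.\<close>

lemma cont_hom_onto_iff:
  assumes g: "cont_hom T g"
  shows "g ` carrier (free_profinite A) = carrier T \<longleftrightarrow>
    (\<forall>S. S \<subseteq> carrier T \<longrightarrow> \<one>\<^bsub>T\<^esub> \<in> S \<longrightarrow> (\<forall>a\<in>A. gen_vals g a \<in> S) \<longrightarrow>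
      (\<forall>x\<in>S. \<forall>y\<in>S. x \<otimes>\<^bsub>T\<^esub> y \<in> S) \<longrightarrow> S = carrier T)" (is "_ \<longleftrightarrow> ?gen")
proof -
  have hom: "g \<in> hom (free_profinite A) T"
    and cont: "continuous_map (free_profinite_top A) (discrete_topology (carrier T)) g"
    using g by (auto simp: cont_hom_def)
  interpret g: group_hom "free_profinite A" T g
    using hom by unfold_locales
  show ?thesis
  proof
    assume onto: "g ` carrier (free_profinite A) = carrier T"
    show ?gen
    proof (intro allI impI)
      fix S assume S: "S \<subseteq> carrier T" "\<one>\<^bsub>T\<^esub> \<in> S" "\<forall>a\<in>A. gen_vals g a \<in> S"
        "\<forall>x\<in>S. \<forall>y\<in>S. x \<otimes>\<^bsub>T\<^esub> y \<in> S"
      have inv: "inv\<^bsub>T\<^esub> x \<in> S" if "x \<in> S" for x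
        using T.finite_mult_closed_inv[OF finite_subset[OF S(1) finite_T] S(1) _ S(2) that] S(4) by blast
      have words: "T.word_val (gen_vals g) w \<in> S" if "w \<in> reduced_words A" for w
        using that
      proof (induction w)
        case (Cons x w)
        then have x: "fst x \<in> A" "T.word_val (gen_vals g) w \<in> S"
          by (auto dest!: reduced_words_ConsD)
        then have "T.letter_val (gen_vals g) x \<in> S" using S(3) inv by (auto simp: T.letter_val_def)
        then show ?case using x S(4) by simp
      qed (simp add: S(2))
      have "g x \<in> S" if x: "x \<in> carrier (free_profinite A)" for x
      proof -
        let ?U = "{y \<in> topspace (free_profinite_top A). g y \<in> {g x}}"
        have "openin (free_profinite_top A) ?U"
          using openin_continuous_map_preimage[OF cont, of "{g x}"] g.hom_closed[OF x] by simp
        moreover have "x \<in> ?U" using x by (simp add: topspace_free_profinite)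
        moreover have "x \<in> free_profinite_top A closure_of (free_embed A ` carrier (free_group A))"
          using x F.dense_to_completion
          by (simp add: free_profinite_def free_profinite_top_def free_embed_def[abs_def])
        ultimately have "\<exists>y. y \<in> free_embed A ` carrier (free_group A) \<and> y \<in> ?U"
          unfolding in_closure_of by meson
        then obtain w where w: "w \<in> carrier (free_group A)" "g (free_embed A w) = g x" by auto
        then show ?thesis
          using words[of w] cont_hom_free_embed[OF g w(1)] by (simp add: free_group_def)
      qed
      then have "g ` carrier (free_profinite A) \<subseteq> S" by (rule image_subsetI)
      then show "S = carrier T" unfolding onto using S(1) by (intro equalityI)
    qed
  next
    assume gen: ?gen
    show "g ` carrier (free_profinite A) = carrier T"
    proof (rule gen[rule_format])
      show "g ` carrier (free_profinite A) \<subseteq> carrier T"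
        using g.hom_closed by (rule image_subsetI)
      show "\<one>\<^bsub>T\<^esub> \<in> g ` carrier (free_profinite A)"
        using g.hom_one by (metis \<Omega>.one_closed imageI)
      show "gen_vals g a \<in> g ` carrier (free_profinite A)" if "a \<in> A" for a
        using free_gen_mem[OF that] that by (simp add: gen_vals_def)
      show "x \<otimes>\<^bsub>T\<^esub> y \<in> g ` carrier (free_profinite A)"
        if "x \<in> g ` carrier (free_profinite A)" "y \<in> g ` carrier (free_profinite A)" for x y
      proof -
        obtain u v where "x = g u" "y = g v" "u \<in> carrier (free_profinite A)" "v \<in> carrier (free_profinite A)"
          using \<open>x \<in> _\<close> \<open>y \<in> _\<close> by (elim imageE)
        then have "x \<otimes>\<^bsub>T\<^esub> y = g (u \<otimes>\<^bsub>free_profinite A\<^esub> v)" "u \<otimes>\<^bsub>free_profinite A\<^esub> v \<in> carrier (free_profinite A)"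
          using g.hom_mult \<Omega>.m_closed by simp_all
        then show ?thesis by (rule image_eqI)
      qed
    qed
  qed
qed

end

text \<open>Each coordinate is a continuous homomorphism to a finite group, so the iterates
  stabilise in it. The definite description in \<open>omega_power\<close> picks the coordinatewise
  limit, which is unique as the space is Hausdorff.\<close>

lemma omega_power_limit:
  assumes x: "x \<in> carrier (free_profinite A)"
  shows "limitin (free_profinite_top A) (\<lambda>n. (\<psi> ^^ fact n) x) (\<omega> x) sequentially"
proof -
  let ?I = "finite_index_normals (free_group A)"
  let ?s = "\<lambda>n. (\<psi> ^^ fact n) x"
  have s: "?s n \<in> carrier F.pc" for n
    using \<psi>_iterate_mem[OF x] by (simp add: free_profinite_def)
  have "\<exists>y. \<forall>\<^sub>F n in sequentially. ?s n N = y" if N: "N \<in> ?I" for N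
  proof -
    have fin: "finite (carrier (free_group A Mod N))" using N by (simp add: finite_index_normals_def)
    have grp: "group (free_group A Mod N)"
      using normal.factorgroup_is_group[OF F.normal_of_finite_index[OF N]] .
    have "cont_hom (free_group A Mod N) (\<lambda>x. x N)"
      unfolding cont_hom_def
    proof
      show "(\<lambda>x. x N) \<in> hom (free_profinite A) (free_group A Mod N)"
        using N F.completion_memD(1)[OF _ N] by (auto intro!: homI simp: free_profinite_def F.mult_completion)
      show "continuous_map (free_profinite_top A) (discrete_topology (carrier (free_group A Mod N))) (\<lambda>x. x N)"
        unfolding free_profinite_top_def profinite_completion_top_def
        by (intro continuous_map_from_subtopology continuous_map_product_projection N)
    qed
    from cont_hom_fact_iterate_eventually_const[OF grp fin this]
    obtain y where "\<forall>\<^sub>F n in sequentially. \<forall>x\<in>carrier (free_profinite A). (\<psi> ^^ fact n) x N = y x" ..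
    then have "\<forall>\<^sub>F n in sequentially. ?s n N = y x"
      by (rule eventually_mono) (use x in blast)
    then show ?thesis by blast
  qed
  then obtain y where y: "\<forall>\<^sub>F n in sequentially. ?s n N = y N" if "N \<in> ?I" for N by metis
  define z where "z = restrict y ?I"
  have z: "\<forall>\<^sub>F n in sequentially. ?s n N = z N" if "N \<in> ?I" for N
    using y[OF that] that by (simp add: z_def)
  have zN: "z N \<in> carrier (free_group A Mod N)" if N: "N \<in> ?I" for N
  proof -
    obtain n where "?s n N = z N" using z[OF N] unfolding eventually_sequentially by blast
    then show ?thesis using F.completion_memD(1)[OF s N] by metis
  qed
  \<comment> \<open>Compatibility concerns two coordinates at a time; both are shared with a common
    iterate \<open>?s n\<close>, which lies in the completion.\<close>
  have z_mono: "z N \<subseteq> z M" if N: "N \<in> ?I" and M: "M \<in> ?I" and "N \<subseteq> M" for N M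
  proof -
    obtain n where "?s n N = z N" "?s n M = z M"
      using eventually_conj[OF z[OF N] z[OF M]] unfolding eventually_sequentially by blast
    then show ?thesis using F.completion_memD(4)[OF s N M \<open>N \<subseteq> M\<close>] by metis
  qed
  have z_mem: "z \<in> carrier F.pc"
    using zN z_mono by (auto simp: F.carrier_completion z_def)
  have sP: "?s n \<in> (\<Pi>\<^sub>E N\<in>?I. carrier (free_group A Mod N))" for n
    using s[of n] unfolding F.carrier_completion by blast
  have "limitin (product_topology (\<lambda>N. discrete_topology (carrier (free_group A Mod N))) ?I) ?s z sequentially"
    unfolding limitin_componentwise
  proof (intro conjI ballI)
    show "z \<in> extensional ?I" by (simp add: z_def)
    show "\<forall>\<^sub>F n in sequentially.
        ?s n \<in> topspace (product_topology (\<lambda>N. discrete_topology (carrier (free_group A Mod N))) ?I)"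
      unfolding topspace_product_topology topspace_discrete_topology using sP by (intro always_eventually allI)
    show "limitin (discrete_topology (carrier (free_group A Mod N))) (\<lambda>n. ?s n N) (z N) sequentially"
      if "N \<in> ?I" for N
      using zN[OF that] z[OF that] by (intro limitin_eventually) (simp_all only: topspace_discrete_topology)
  qed
  then have lim: "limitin (free_profinite_top A) ?s z sequentially"
    unfolding free_profinite_top_def profinite_completion_top_def limitin_subtopology
    using z_mem s by (intro conjI always_eventually allI)
  have "(THE y. limitin (free_profinite_top A) ?s y sequentially) = z"
    using lim limitin_Hausdorff_unique[OF _ lim trivial_limit_sequentially Hausdorff_free_profinite]
    by (rule the_equality)
  then have "\<omega> x = z"
    unfolding omega_power_def topspace_free_profinite using x by (simp only: restrict_apply if_True)
  then show ?thesis using lim by (simp only:)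
qed

lemma omega_power_mem: "x \<in> carrier (free_profinite A) \<Longrightarrow> \<omega> x \<in> carrier (free_profinite A)"
  using limitin_topspace[OF omega_power_limit] unfolding topspace_free_profinite .

lemma cont_hom_omega_power:
  assumes g: "cont_hom T g" and x: "x \<in> carrier (free_profinite A)"
  shows "\<forall>\<^sub>F n in sequentially. g ((\<psi> ^^ fact n) x) = g (\<omega> x)"
proof -
  have "continuous_map (free_profinite_top A) (discrete_topology (carrier T)) g"
    using g by (simp only: cont_hom_def)
  then have lim: "limitin (discrete_topology (carrier T)) (g \<circ> (\<lambda>n. (\<psi> ^^ fact n) x)) (g (\<omega> x)) sequentially"
    using omega_power_limit[OF x] by (rule continuous_map_limit)
  have "g (\<omega> x) \<in> carrier T"
    using limitin_topspace[OF lim] unfolding topspace_discrete_topology .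
  then have "openin (discrete_topology (carrier T)) {g (\<omega> x)}"
    unfolding openin_discrete_topology by blast
  then have "\<forall>\<^sub>F n in sequentially. (g \<circ> (\<lambda>n. (\<psi> ^^ fact n) x)) n \<in> {g (\<omega> x)}"
    using lim unfolding limitin_def by blast
  then show ?thesis unfolding comp_def singleton_iff .
qed

text \<open>As \<open>A\<close> is finite, \<open>g\<close> attains its limit values on all
  generators from a common \<open>n\<close> on. So the relations hold iff the iterates of
  \<open>transfer T\<close> with exponent \<open>n!\<close> fix the tuple for all large
  \<open>n\<close>, which is periodicity.\<close>

lemma cont_hom_omega_power_fixes_iff:
  assumes T: "group T" "finite (carrier T)" and g: "cont_hom T g"
  shows "(\<forall>a\<in>A. g (\<omega> (free_gen A a)) = g (free_gen A a)) \<longleftrightarrow>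
    (\<exists>p>0. (transfer T ^^ p) (gen_vals g) = gen_vals g)"
proof -
  have ev: "\<forall>\<^sub>F n in sequentially. \<forall>a\<in>A. g ((\<psi> ^^ fact n) (free_gen A a)) = g (\<omega> (free_gen A a))"
    by (intro eventually_ball_finite ballI finite_A cont_hom_omega_power[OF g free_gen_mem])
  have iff: "(transfer T ^^ fact n) (gen_vals g) = gen_vals g \<longleftrightarrow>
      (\<forall>a\<in>A. g ((\<psi> ^^ fact n) (free_gen A a)) = g (free_gen A a))" for n
    unfolding gen_vals_iterate[OF T g, symmetric] by (rule gen_vals_eq_iff)
  have "(\<forall>a\<in>A. g (\<omega> (free_gen A a)) = g (free_gen A a)) \<longleftrightarrow>
    (\<forall>\<^sub>F n in sequentially. (transfer T ^^ fact n) (gen_vals g) = gen_vals g)" (is "?L \<longleftrightarrow> ?R")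
  proof
    assume ?L
    with ev show ?R unfolding iff by (elim eventually_mono) simp
  next
    assume ?R
    \<comment> \<open>The statement \<open>?L\<close> does not depend on \<open>n\<close>, so
      holding eventually means holding.\<close>
    then have "\<forall>\<^sub>F n in sequentially. ?L"
      using ev unfolding iff by eventually_elim simp
    then show ?L unfolding eventually_const_iff using trivial_limit_sequentially by blast
  qed
  then show ?thesis by (simp only: funpow_fact_eventually_fixed_iff)
qed

text \<open>All conditions on \<open>g\<close> depend on its tuple alone, and every tuple occurs;
  the search for a homomorphism becomes a search in a finite set.\<close>

theorem epi_presentation_iff_periodic:
  fixes T :: "('c, 'd) monoid_scheme"
  assumes T: "group T" "finite (carrier T)"
  defines "R \<equiv> (\<lambda>a. (\<omega> (free_gen A a), free_gen A a)) ` A"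
  shows "(\<exists>h \<in> epi (profinite_presentation A R) T.
      continuous_map (profinite_presentation_top A R) (discrete_topology (carrier T)) h) \<longleftrightarrow>
    (\<exists>t \<in> A \<rightarrow>\<^sub>E carrier T. (\<exists>p>0. (transfer T ^^ p) t = t) \<and>
      (\<forall>S. S \<subseteq> carrier T \<longrightarrow> \<one>\<^bsub>T\<^esub> \<in> S \<longrightarrow> (\<forall>a\<in>A. t a \<in> S) \<longrightarrow>
        (\<forall>x\<in>S. \<forall>y\<in>S. x \<otimes>\<^bsub>T\<^esub> y \<in> S) \<longrightarrow> S = carrier T))" (is "?L \<longleftrightarrow> (\<exists>t\<in>_. ?per t \<and> ?gen t)")
proof -
  have R: "R \<subseteq> carrier (free_profinite A) \<times> carrier (free_profinite A)"
    using omega_power_mem free_gen_mem by (auto simp: R_def)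
  have "?L \<longleftrightarrow> (\<exists>g \<in> epi (free_profinite A) T.
      continuous_map (free_profinite_top A) (discrete_topology (carrier T)) g \<and> (\<forall>(u, v)\<in>R. g u = g v))"
    unfolding profinite_presentation_def profinite_presentation_top_def
    by (rule epi_presentation_iff[OF topspace_free_profinite \<Omega>.m_closed R])
  also have "\<dots> \<longleftrightarrow> (\<exists>g. cont_hom T g \<and> g ` carrier (free_profinite A) = carrier T \<and>
      (\<forall>a\<in>A. g (\<omega> (free_gen A a)) = g (free_gen A a)))"
    by (auto simp: cont_hom_def epi_def R_def)
  also have "\<dots> \<longleftrightarrow> (\<exists>g. cont_hom T g \<and> ?gen (gen_vals g) \<and> ?per (gen_vals g))"
    using cont_hom_onto_iff[OF T] cont_hom_omega_power_fixes_iff[OF T] by (intro ex_cong1) blast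
  also have "\<dots> \<longleftrightarrow> (\<exists>t \<in> A \<rightarrow>\<^sub>E carrier T. ?per t \<and> ?gen t)"
  proof
    assume "\<exists>g. cont_hom T g \<and> ?gen (gen_vals g) \<and> ?per (gen_vals g)"
    then obtain g where g: "cont_hom T g \<and> ?gen (gen_vals g) \<and> ?per (gen_vals g)" ..
    then show "\<exists>t \<in> A \<rightarrow>\<^sub>E carrier T. ?per t \<and> ?gen t"
      using gen_vals_mem[OF T conjunct1[OF g]] by (intro bexI[of _ "gen_vals g"]) simp_all
  next
    assume "\<exists>t \<in> A \<rightarrow>\<^sub>E carrier T. ?per t \<and> ?gen t"
    then obtain t where t: "t \<in> A \<rightarrow>\<^sub>E carrier T" "?per t \<and> ?gen t" ..
    obtain g where g: "cont_hom T g" "gen_vals g = t" using cont_hom_exists[OF T t(1)] .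
    show "\<exists>g. cont_hom T g \<and> ?gen (gen_vals g) \<and> ?per (gen_vals g)"
      using t(2) g by (intro exI[of _ g]) simp
  qed
  finally show ?thesis .
qed

end

section \<open>The decision procedure\<close>

definition tbl_mult :: "nat \<Rightarrow> nat \<Rightarrow> nat \<Rightarrow> nat \<Rightarrow> nat" where
  "tbl_mult n c x y = code_nth c (x * n + y)"

text \<open>The guard makes the search succeed (with result \<open>n\<close>) also when there is no inverse, as
  minimization is restricted to regular functions.\<close>

definition tbl_inv :: "nat \<Rightarrow> nat \<Rightarrow> nat \<Rightarrow> nat \<Rightarrow> nat" where
  "tbl_inv n c e x = (LEAST y. y < n \<longrightarrow> tbl_mult n c y x = e)"

text \<open>Here \<open>z\<close> codes a tuple whose entry at the letter \<open>a\<close> is digit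
  number \<open>idx a\<close>, and \<open>e\<close> is the presumed identity.\<close>

definition tbl_word :: "('a \<Rightarrow> nat) \<Rightarrow> nat \<Rightarrow> nat \<Rightarrow> nat \<Rightarrow> nat \<Rightarrow> 'a fword \<Rightarrow> nat" where
  "tbl_word idx n c e z w =
     foldr (\<lambda>x y. tbl_mult n c (if snd x then digit n (idx (fst x)) z
                                else tbl_inv n c e (digit n (idx (fst x)) z)) y) w e"

text \<open>The counterpart of \<open>transfer\<close> on codes, when \<open>ws i\<close> is the
  image of the \<open>i\<close>-th generator.\<close>

definition tbl_step :: "('a \<Rightarrow> nat) \<Rightarrow> (nat \<Rightarrow> 'a fword) \<Rightarrow> nat \<Rightarrow> nat \<Rightarrow> nat \<Rightarrow> nat \<Rightarrow> nat \<Rightarrow> nat" where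
  "tbl_step idx ws k n c e z = (\<Sum>i<k. tbl_word idx n c e z (ws i) * n ^ i)"

text \<open>Associativity is part of \<open>finite_semigroup_table\<close>; a left identity and left
  inverses then suffice for a group.\<close>

definition tbl_group :: "nat \<Rightarrow> nat \<Rightarrow> nat \<Rightarrow> bool" where
  "tbl_group n c e \<longleftrightarrow> (\<forall>x<n. tbl_mult n c e x = x \<and> (\<exists>y<n. tbl_mult n c y x = e))"

text \<open>Subsets of \<open>{..<N}\<close> are coded by the numbers below \<open>2 ^ N\<close>, tuples \<open>{..<k} \<rightarrow> {..<n}\<close> by the
  numbers below \<open>n ^ k\<close>. Quantifying over all subsets closed under a map replaces the
  iteration of that map.\<close>

definition tbl_generates :: "nat \<Rightarrow> nat \<Rightarrow> nat \<Rightarrow> nat \<Rightarrow> nat \<Rightarrow> bool" where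
  "tbl_generates k n c e z \<longleftrightarrow>
     (\<forall>s<2 ^ n. digit 2 e s = 1 \<and> (\<forall>i<k. digit 2 (digit n i z) s = 1) \<and>
        (\<forall>x<n. \<forall>y<n. digit 2 x s = 1 \<and> digit 2 y s = 1 \<longrightarrow> digit 2 (tbl_mult n c x y) s = 1) \<longrightarrow>
      (\<forall>x<n. digit 2 x s = 1))"

definition tbl_periodic :: "('a \<Rightarrow> nat) \<Rightarrow> (nat \<Rightarrow> 'a fword) \<Rightarrow> nat \<Rightarrow> nat \<Rightarrow> nat \<Rightarrow> nat \<Rightarrow> nat \<Rightarrow> bool" where
  "tbl_periodic idx ws k n c e z \<longleftrightarrow>
     (\<forall>s<2 ^ n ^ k. digit 2 (tbl_step idx ws k n c e z) s = 1 \<and>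
        (\<forall>y<n ^ k. digit 2 y s = 1 \<longrightarrow> digit 2 (tbl_step idx ws k n c e y) s = 1) \<longrightarrow>
      digit 2 z s = 1)"

text \<open>The input names no identity, so \<open>e\<close> is searched for. For
  \<open>n = 0\<close> nothing is accepted, rightly so: a nonempty group has no map to the empty
  semigroup.\<close>

definition tbl_accepts :: "('a \<Rightarrow> nat) \<Rightarrow> (nat \<Rightarrow> 'a fword) \<Rightarrow> nat \<Rightarrow> nat \<Rightarrow> nat \<Rightarrow> bool" where
  "tbl_accepts idx ws k n c \<longleftrightarrow>
     (\<exists>e<n. tbl_group n c e \<and>
       (\<exists>z<n ^ k. tbl_periodic idx ws k n c e z \<and> tbl_generates k n c e z))"

section \<open>Recursiveness of the decision procedure\<close>

lemma rec_tbl_mult: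
  assumes "total_recursive N n" "total_recursive N c" "total_recursive N x" "total_recursive N y"
  shows "total_recursive N (\<lambda>xs. tbl_mult (n xs) (c xs) (x xs) (y xs))"
  unfolding tbl_mult_def by (intro rec_code_nth rec_intros assms)

lemma rec_tbl_inv:
  assumes "total_recursive N n" "total_recursive N c" "total_recursive N e" "total_recursive N x"
  shows "total_recursive N (\<lambda>xs. tbl_inv (n xs) (c xs) (e xs) (x xs))"
  unfolding tbl_inv_def
proof (rule rec_Least)
  show "recursive_pred (Suc N) (\<lambda>ys. ys ! 0 < n (tl ys) \<longrightarrow>
      tbl_mult (n (tl ys)) (c (tl ys)) (ys ! 0) (x (tl ys)) = e (tl ys))"
    by (intro rec_imp rec_less rec_eq rec_tbl_mult rec_nth rec_tl assms) auto
  show "\<exists>k. k < n xs \<longrightarrow> tbl_mult (n xs) (c xs) k (x xs) = e xs" for xs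
    by (rule exI[of _ "n xs"]) simp
qed

text \<open>The word is a constant of the program and not an input: induction unrolls its evaluation
  into finitely many compositions.\<close>

lemma rec_tbl_word:
  assumes "total_recursive N n" "total_recursive N c" "total_recursive N e" "total_recursive N z"
  shows "total_recursive N (\<lambda>xs. tbl_word idx (n xs) (c xs) (e xs) (z xs) w)"
proof (induction w)
  case (Cons x w)
  have "total_recursive N (\<lambda>xs. digit (n xs) (idx (fst x)) (z xs))"
    by (intro rec_digit rec_const assms)
  then show ?case
    using Cons.IH assms by (cases "snd x") (auto simp: tbl_word_def intro!: rec_tbl_mult rec_tbl_inv)
qed (simp add: tbl_word_def assms)

lemma rec_tbl_step:
  assumes "total_recursive N n" "total_recursive N c" "total_recursive N e" "total_recursive N z"
  shows "total_recursive N (\<lambda>xs. tbl_step idx ws k (n xs) (c xs) (e xs) (z xs))"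
  unfolding tbl_step_def by (intro rec_sum rec_mult rec_power rec_tbl_word rec_const assms)

lemma rec_tbl_group:
  assumes "total_recursive N n" "total_recursive N c" "total_recursive N e"
  shows "recursive_pred N (\<lambda>xs. tbl_group (n xs) (c xs) (e xs))"
  unfolding tbl_group_def
  by (intro rec_all_less rec_ex_less rec_conj rec_eq rec_tbl_mult rec_nth rec_tl assms) auto

lemma rec_tbl_generates:
  assumes "total_recursive N n" "total_recursive N c" "total_recursive N e" "total_recursive N z"
  shows "recursive_pred N (\<lambda>xs. tbl_generates k (n xs) (c xs) (e xs) (z xs))"
  unfolding tbl_generates_def
  by (intro rec_all_less rec_conj rec_imp rec_eq rec_power rec_tbl_mult rec_digit rec_const
      rec_nth rec_tl assms) auto

lemma rec_tbl_periodic: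
  assumes "total_recursive N n" "total_recursive N c" "total_recursive N e" "total_recursive N z"
  shows "recursive_pred N (\<lambda>xs. tbl_periodic idx ws k (n xs) (c xs) (e xs) (z xs))"
  unfolding tbl_periodic_def
  by (intro rec_all_less rec_conj rec_imp rec_eq rec_power rec_tbl_step rec_digit rec_const
      rec_nth rec_tl assms) auto

lemma rec_tbl_accepts:
  "recursive_pred (Suc (Suc 0)) (\<lambda>xs. tbl_accepts idx ws k (xs ! 0) (xs ! 1))"
  unfolding tbl_accepts_def
  by (intro rec_ex_less rec_conj rec_power rec_tbl_group rec_tbl_periodic rec_tbl_generates
      rec_const rec_nth rec_tl) auto

section \<open>Codes of subsets, periodic points and multiplication tables\<close>

lemma subset_code:
  assumes "X \<subseteq> {..<N}"
  obtains s where "s < 2 ^ N" "\<And>y. y < N \<Longrightarrow> digit 2 y s = 1 \<longleftrightarrow> y \<in> X"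
proof -
  let ?s = "\<Sum>j<N. of_bool (j \<in> X) * 2 ^ j :: nat"
  have "?s < 2 ^ N" by (rule sum_digits_less) simp
  moreover have "digit 2 y ?s = 1 \<longleftrightarrow> y \<in> X" if "y < N" for y
    using that by (subst digit_sum) auto
  ultimately show ?thesis by (rule that)
qed

text \<open>A point \<open>z\<close> is periodic iff it lies in the forward orbit of
  \<open>f z\<close>, which is the least \<open>f\<close>-closed set containing
  \<open>f z\<close>.\<close>

lemma periodic_iff_closed_sets:
  assumes "f \<in> {..<N} \<rightarrow> {..<N}" "z < N"
  shows "(\<forall>s<2 ^ N. digit 2 (f z) s = 1 \<and> (\<forall>y<N. digit 2 y s = 1 \<longrightarrow> digit 2 (f y) s = 1) \<longrightarrow>
      digit 2 z s = 1) \<longleftrightarrow> (\<exists>p>0. (f ^^ p) z = z)" (is "?L \<longleftrightarrow> ?R")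
proof
  \<comment> \<open>Exponent 0 is left out, so that membership of \<open>z\<close> means
    periodicity.\<close>
  let ?X = "{(f ^^ p) z | p. p > 0}"
  have X: "?X \<subseteq> {..<N}"
    using funpow_closed[OF assms(1), of z] assms(2) by auto
  assume L: ?L
  obtain s where s: "s < 2 ^ N" "\<And>y. y < N \<Longrightarrow> digit 2 y s = 1 \<longleftrightarrow> y \<in> ?X"
    by (rule subset_code[OF X]) (rule that)
  have mem: "digit 2 y s = 1" if "y \<in> ?X" for y
  proof -
    have "y < N" using subsetD[OF X that] by simp
    then show ?thesis using s(2) that by simp
  qed
  have closed: "f y \<in> ?X" if "y \<in> ?X" for y
  proof -
    from that obtain p where "y = (f ^^ p) z" by blast
    then have "f y = (f ^^ Suc p) z" by simp
    then show ?thesis by blast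
  qed
  have "f z \<in> ?X" using zero_less_one by (force intro: exI[of _ "1::nat"])
  then have "digit 2 (f z) s = 1" by (rule mem)
  moreover have "\<forall>y<N. digit 2 y s = 1 \<longrightarrow> digit 2 (f y) s = 1"
  proof (intro allI impI)
    fix y assume "y < N" "digit 2 y s = 1"
    then have "y \<in> ?X" using s(2) by simp
    then show "digit 2 (f y) s = 1" by (intro mem closed)
  qed
  ultimately have "digit 2 z s = 1" using L[rule_format, OF s(1)] by simp
  with s(2)[OF assms(2)] show ?R by auto
next
  assume ?R
  then obtain p where p: "p > 0" "(f ^^ p) z = z" by blast
  show ?L
  proof (intro allI impI)
    fix s assume s: "digit 2 (f z) s = 1 \<and> (\<forall>y<N. digit 2 y s = 1 \<longrightarrow> digit 2 (f y) s = 1)"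
    have "digit 2 ((f ^^ Suc q) z) s = 1" for q
    proof (induction q)
      case (Suc q)
      then show ?case using s funpow_closed[OF assms(1), of z "Suc q"] assms(2) by simp
    qed (use s in simp)
    then show "digit 2 z s = 1" using p by (metis Suc_pred)
  qed
qed

text \<open>The number \<open>k\<close> of rows is kept apart from their length \<open>n\<close>, so
  that the induction can add one row.\<close>

lemma nth_concat_table:
  "i < k \<Longrightarrow> j < n \<Longrightarrow> concat (map (\<lambda>i. map (m i) [0..<n]) [0..<k]) ! (i * n + j) = m i j"
proof (induction k)
  case (Suc k)
  have len: "length (concat (map (\<lambda>i. map (m i) [0..<n]) [0..<l])) = l * n" for l
    by (induction l) auto
  show ?case
  proof (cases "i = k")
    case False
    then have "i < k" using Suc.prems by simp
    then have "i * n + j < k * n"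
      using Suc.prems(2) mult_le_mono1[of "Suc i" k n] by simp
    then show ?thesis using Suc \<open>i < k\<close> by (simp add: nth_append len)
  qed (use Suc.prems in \<open>simp add: nth_append len\<close>)
qed simp

lemma tbl_mult_table_code:
  assumes "x < n" "y < n"
  shows "tbl_mult n (table_code n m) x y = m x y"
proof -
  have "length (concat (map (\<lambda>i. map (m i) [0..<n]) [0..<l])) = l * n" for l
    by (induction l) auto
  moreover have "x * n + y < n * n"
    using assms mult_le_mono1[of "Suc x" n n] by simp
  ultimately show ?thesis
    using assms by (simp add: tbl_mult_def table_code_def code_nth_list_encode nth_concat_table)
qed

section \<open>Correctness of the decision procedure\<close>

context free_group_endo
begin

context
  fixes n :: nat and m :: "nat \<Rightarrow> nat \<Rightarrow> nat" and idx :: "'a \<Rightarrow> nat" and el :: "nat \<Rightarrow> 'a"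
  assumes tbl: "finite_semigroup_table n m"
    and el: "bij_betw el {..<card A} A" and idx: "\<And>i. i < card A \<Longrightarrow> idx (el i) = i"
begin

text \<open>The unit of \<open>table_semigroup\<close> is meaningless; putting \<open>e\<close> in
  its place makes it possible to ask whether the table is a group.\<close>

abbreviation "\<T> e \<equiv> \<lparr>carrier = {..<n}, monoid.mult = m, one = e\<rparr>"
abbreviation "cd \<equiv> table_code n m"
abbreviation "ws i \<equiv> \<phi> [(el i, True)]"

lemma idx_less:
  assumes "a \<in> A" shows "idx a < card A \<and> el (idx a) = a"
proof -
  obtain i where "i < card A" "a = el i"
    using assms bij_betw_imp_surj_on[OF el] by blast
  then show ?thesis using idx by simp
qed

lemma el_mem: "i < card A \<Longrightarrow> el i \<in> A"
  using el by (auto simp: bij_betw_def)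

lemma tbl_group_iff:
  assumes "e < n" shows "tbl_group n cd e \<longleftrightarrow> group (\<T> e)"
proof
  assume g: "tbl_group n cd e"
  show "group (\<T> e)"
  proof (rule groupI)
    fix x assume "x \<in> carrier (\<T> e)"
    then obtain y where "y < n" "tbl_mult n cd y x = e" "x < n"
      using g by (auto simp: tbl_group_def)
    then show "\<exists>y\<in>carrier (\<T> e). y \<otimes>\<^bsub>\<T> e\<^esub> x = \<one>\<^bsub>\<T> e\<^esub>"
      by (auto simp: tbl_mult_table_code)
  qed (use tbl g assms in
      \<open>auto simp: finite_semigroup_table_def tbl_group_def tbl_mult_table_code\<close>)
next
  assume "group (\<T> e)"
  then interpret group "\<T> e" .
  show "tbl_group n cd e"
    unfolding tbl_group_def
  proof (intro allI impI conjI)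
    fix x assume x: "x < n"
    show "tbl_mult n cd e x = x" using l_one[of x] x assms by (simp add: tbl_mult_table_code)
    show "\<exists>y<n. tbl_mult n cd y x = e"
      using l_inv_ex[of x] x by (auto simp: tbl_mult_table_code)
  qed
qed

definition tuple_of :: "nat \<Rightarrow> 'a \<Rightarrow> nat" where
  "tuple_of z = (\<lambda>a\<in>A. digit n (idx a) z)"

definition tuple_code :: "('a \<Rightarrow> nat) \<Rightarrow> nat" where
  "tuple_code t = (\<Sum>i<card A. t (el i) * n ^ i)"

lemma tuple_code_less: "t \<in> A \<rightarrow> {..<n} \<Longrightarrow> tuple_code t < n ^ card A"
  unfolding tuple_code_def using el_mem by (intro sum_digits_less) auto

lemma tuple_of_code: "t \<in> A \<rightarrow>\<^sub>E {..<n} \<Longrightarrow> tuple_of (tuple_code t) = t"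
proof
  fix a assume t: "t \<in> A \<rightarrow>\<^sub>E {..<n}"
  show "tuple_of (tuple_code t) a = t a"
  proof (cases "a \<in> A")
    case True
    have "digit n (idx a) (tuple_code t) = t (el (idx a))"
      unfolding tuple_code_def using t el_mem idx_less[OF True] by (intro digit_sum) auto
    then show ?thesis using True idx_less by (simp add: tuple_of_def)
  qed (use t in \<open>auto simp: tuple_of_def\<close>)
qed

lemma all_less_card_iff: "(\<forall>i<card A. P (digit n i z)) \<longleftrightarrow> (\<forall>a\<in>A. P (tuple_of z a))"
proof
  assume "\<forall>i<card A. P (digit n i z)"
  then show "\<forall>a\<in>A. P (tuple_of z a)" using idx_less by (simp add: tuple_of_def)
next
  assume P: "\<forall>a\<in>A. P (tuple_of z a)"
  show "\<forall>i<card A. P (digit n i z)"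
    using P[rule_format, OF el_mem] el_mem idx by (simp add: tuple_of_def)
qed

context
  fixes e
  assumes e: "e < n" and grp: "group (\<T> e)"
begin

interpretation T: group "\<T> e" by (rule grp)

lemma finite_table: "finite (carrier (\<T> e))" by simp

lemma tuple_of_mem: "tuple_of z \<in> A \<rightarrow>\<^sub>E {..<n}"
  using e by (auto simp: tuple_of_def digit_less)

text \<open>Below \<open>n\<close> the inverse is the only solution, by uniqueness of left inverses;
  any other \<open>y\<close> passes only through the guard and is at least \<open>n\<close>.\<close>

lemma tbl_inv_eq:
  assumes x: "x < n" shows "tbl_inv n cd e x = inv\<^bsub>\<T> e\<^esub> x"
  unfolding tbl_inv_def
proof (rule Least_equality)
  have inv: "inv\<^bsub>\<T> e\<^esub> x < n" "m (inv\<^bsub>\<T> e\<^esub> x) x = e"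
    using T.inv_closed[of x] T.l_inv[of x] x by auto
  then show "inv\<^bsub>\<T> e\<^esub> x < n \<longrightarrow> tbl_mult n cd (inv\<^bsub>\<T> e\<^esub> x) x = e"
    using x by (simp add: tbl_mult_table_code)
  fix y assume y: "y < n \<longrightarrow> tbl_mult n cd y x = e"
  show "inv\<^bsub>\<T> e\<^esub> x \<le> y"
  proof (cases "y < n")
    case True
    then show ?thesis using y x T.inv_equality[of y x] by (simp add: tbl_mult_table_code)
  qed (use inv in simp)
qed

lemma tbl_word_eq:
  "w \<in> reduced_words A \<Longrightarrow> tbl_word idx n cd e z w = T.word_val (tuple_of z) w"
proof (induction w)
  case (Cons x w)
  then have x: "fst x \<in> A" "w \<in> reduced_words A" by (auto dest!: reduced_words_ConsD)
  have t: "tuple_of z \<in> A \<rightarrow> carrier (\<T> e)" using tuple_of_mem[of z] by auto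
  have "(if snd x then digit n (idx (fst x)) z else tbl_inv n cd e (digit n (idx (fst x)) z))
      = T.letter_val (tuple_of z) x"
    using x e by (simp add: T.letter_val_def tuple_of_def tbl_inv_eq digit_less)
  then have "tbl_word idx n cd e z (x # w)
      = tbl_mult n cd (T.letter_val (tuple_of z) x) (T.word_val (tuple_of z) w)"
    using Cons.IH[OF x(2)] by (simp add: tbl_word_def)
  also have "\<dots> = m (T.letter_val (tuple_of z) x) (T.word_val (tuple_of z) w)"
    using T.letter_val_closed[OF t x(1)] T.word_val_closed[OF t x(2)]
    by (intro tbl_mult_table_code) simp_all
  finally show ?case by simp
qed (simp add: tbl_word_def)

abbreviation "step \<equiv> tbl_step idx ws (card A) n cd e"

lemma step_eq: "step z = tuple_code (transfer (\<T> e) (tuple_of z))"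
  unfolding tbl_step_def tuple_code_def
proof (rule sum.cong[OF refl])
  fix i assume "i \<in> {..<card A}"
  then have i: "el i \<in> A" using el_mem by simp
  then have "ws i \<in> reduced_words A"
    using hom_in_carrier[OF \<phi>_hom letter_mem[of "(el i, True)"]] by (simp add: free_group_def)
  then show "tbl_word idx n cd e z (ws i) * n ^ i = transfer (\<T> e) (tuple_of z) (el i) * n ^ i"
    using i by (simp add: tbl_word_eq transfer_def)
qed

lemma transfer_tuple_mem: "t \<in> A \<rightarrow>\<^sub>E {..<n} \<Longrightarrow> transfer (\<T> e) t \<in> A \<rightarrow>\<^sub>E {..<n}"
  using transfer_mem[OF grp finite_table, of t] by simp

lemma step_less: "step z < n ^ card A"
proof -
  have "transfer (\<T> e) (tuple_of z) \<in> A \<rightarrow> {..<n}"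
    using transfer_tuple_mem[OF tuple_of_mem] by auto
  then show ?thesis unfolding step_eq by (rule tuple_code_less)
qed

text \<open>This takes a periodic number to a periodic tuple; \<open>step_iterate_code\<close> goes
  the other way. Both rest on \<open>tuple_of_code\<close> alone, so the opposite composite of
  coding and decoding is never computed.\<close>

lemma tuple_of_step_iterate: "tuple_of ((step ^^ p) z) = (transfer (\<T> e) ^^ p) (tuple_of z)"
proof (induction p)
  case (Suc p)
  have "tuple_of ((step ^^ Suc p) z) = transfer (\<T> e) (tuple_of ((step ^^ p) z))"
    using tuple_of_code[OF transfer_tuple_mem[OF tuple_of_mem]] by (simp add: step_eq)
  then show ?case using Suc by simp
qed simp

lemma step_iterate_code:
  assumes "t \<in> A \<rightarrow>\<^sub>E {..<n}"
  shows "(step ^^ p) (tuple_code t) = tuple_code ((transfer (\<T> e) ^^ p) t)"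
proof (induction p)
  case (Suc p)
  have "(transfer (\<T> e) ^^ p) t \<in> A \<rightarrow>\<^sub>E {..<n}"
    using transfer_tuple_mem assms by (intro funpow_closed funcsetI)
  then show ?case using Suc by (simp add: step_eq tuple_of_code)
qed simp

lemma tbl_periodic_iff:
  assumes "z < n ^ card A"
  shows "tbl_periodic idx ws (card A) n cd e z \<longleftrightarrow> (\<exists>p>0. (step ^^ p) z = z)"
  unfolding tbl_periodic_def
  using assms step_less by (intro periodic_iff_closed_sets) auto

lemma tbl_generates_iff:
  "tbl_generates (card A) n cd e z \<longleftrightarrow>
    (\<forall>S. S \<subseteq> carrier (\<T> e) \<longrightarrow> \<one>\<^bsub>\<T> e\<^esub> \<in> S \<longrightarrow> (\<forall>a\<in>A. tuple_of z a \<in> S) \<longrightarrow>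
      (\<forall>x\<in>S. \<forall>y\<in>S. x \<otimes>\<^bsub>\<T> e\<^esub> y \<in> S) \<longrightarrow> S = carrier (\<T> e))" (is "_ \<longleftrightarrow> ?R")
proof
  assume gen: "tbl_generates (card A) n cd e z"
  show ?R
  proof (intro allI impI)
    fix S assume S: "S \<subseteq> carrier (\<T> e)" "\<one>\<^bsub>\<T> e\<^esub> \<in> S" "\<forall>a\<in>A. tuple_of z a \<in> S"
      "\<forall>x\<in>S. \<forall>y\<in>S. x \<otimes>\<^bsub>\<T> e\<^esub> y \<in> S"
    obtain s where s: "s < 2 ^ n" "\<And>y. y < n \<Longrightarrow> digit 2 y s = 1 \<longleftrightarrow> y \<in> S"
      using subset_code[of S n] S(1) by auto
    have "\<forall>i<card A. digit 2 (digit n i z) s = 1"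
      unfolding all_less_card_iff[of "\<lambda>x. digit 2 x s = 1"] using S(1,3) s(2) by auto
    moreover have "digit 2 e s = 1" using s(2)[OF e] S(2) by simp
    moreover have "digit 2 (tbl_mult n cd x y) s = 1"
      if "x < n" "y < n" "digit 2 x s = 1" "digit 2 y s = 1" for x y
    proof -
      have "m x y \<in> S" using S(4) s(2) that by simp
      then show ?thesis using S(1) s(2)[of "m x y"] that by (auto simp: tbl_mult_table_code)
    qed
    ultimately have "\<forall>x<n. digit 2 x s = 1"
      using gen s(1) unfolding tbl_generates_def by blast
    then show "S = carrier (\<T> e)" using s(2) S(1) by auto
  qed
next
  assume R: ?R
  show "tbl_generates (card A) n cd e z"
    unfolding tbl_generates_def
  proof (intro allI impI, elim conjE)
    fix s x
    assume e': "digit 2 e s = 1" and t: "\<forall>i<card A. digit 2 (digit n i z) s = 1"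
      and mult: "\<forall>x<n. \<forall>y<n. digit 2 x s = 1 \<and> digit 2 y s = 1 \<longrightarrow> digit 2 (tbl_mult n cd x y) s = 1"
      and x: "x < n"
    let ?S = "{y. y < n \<and> digit 2 y s = 1}"
    have "?S = carrier (\<T> e)"
    proof (rule R[rule_format])
      show "tuple_of z a \<in> ?S" if "a \<in> A" for a
        using t that tuple_of_mem[of z] unfolding all_less_card_iff[of "\<lambda>x. digit 2 x s = 1"] by auto
      show "x \<otimes>\<^bsub>\<T> e\<^esub> y \<in> ?S" if "x \<in> ?S" "y \<in> ?S" for x y
        using mult that tbl by (auto simp: tbl_mult_table_code finite_semigroup_table_def)
    qed (use e e' in auto)
    then show "digit 2 x s = 1" using x by auto
  qed
qed

lemma periodic_generating_tuple_iff:
  "(\<exists>z<n ^ card A. tbl_periodic idx ws (card A) n cd e z \<and> tbl_generates (card A) n cd e z) \<longleftrightarrow>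
   (\<exists>t \<in> A \<rightarrow>\<^sub>E carrier (\<T> e). (\<exists>p>0. (transfer (\<T> e) ^^ p) t = t) \<and>
      (\<forall>S. S \<subseteq> carrier (\<T> e) \<longrightarrow> \<one>\<^bsub>\<T> e\<^esub> \<in> S \<longrightarrow> (\<forall>a\<in>A. t a \<in> S) \<longrightarrow>
        (\<forall>x\<in>S. \<forall>y\<in>S. x \<otimes>\<^bsub>\<T> e\<^esub> y \<in> S) \<longrightarrow> S = carrier (\<T> e)))"
    (is "_ \<longleftrightarrow> (\<exists>t\<in>_. ?per t \<and> ?gen t)")
proof
  assume "\<exists>z<n ^ card A. tbl_periodic idx ws (card A) n cd e z \<and> tbl_generates (card A) n cd e z"
  then obtain z where z: "z < n ^ card A" "tbl_periodic idx ws (card A) n cd e z"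
    "tbl_generates (card A) n cd e z" by blast
  then obtain p where p: "p > 0" "(step ^^ p) z = z" using tbl_periodic_iff by blast
  then have "?per (tuple_of z)" by (metis tuple_of_step_iterate)
  moreover have "?gen (tuple_of z)" using z(3) tbl_generates_iff by blast
  moreover have "tuple_of z \<in> A \<rightarrow>\<^sub>E carrier (\<T> e)" using tuple_of_mem by simp
  ultimately show "\<exists>t \<in> A \<rightarrow>\<^sub>E carrier (\<T> e). ?per t \<and> ?gen t" by (intro bexI conjI)
next
  assume "\<exists>t \<in> A \<rightarrow>\<^sub>E carrier (\<T> e). ?per t \<and> ?gen t"
  then obtain t where t: "t \<in> A \<rightarrow>\<^sub>E {..<n}" and per: "?per t" and gen: "?gen t" by auto
  have z: "tuple_code t < n ^ card A" using t by (intro tuple_code_less) auto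
  obtain p where "p > 0" "(transfer (\<T> e) ^^ p) t = t" using per by blast
  then have "tbl_periodic idx ws (card A) n cd e (tuple_code t)"
    unfolding tbl_periodic_iff[OF z] using step_iterate_code[OF t] by metis
  moreover have "tbl_generates (card A) n cd e (tuple_code t)"
    unfolding tbl_generates_iff tuple_of_code[OF t] by (rule gen)
  ultimately show "\<exists>z<n ^ card A. tbl_periodic idx ws (card A) n cd e z \<and> tbl_generates (card A) n cd e z"
    using z by blast
qed

end

text \<open>If some \<open>e\<close> makes the table a group, both sides mean that a periodic
  generating tuple exists. If none does, there is no epimorphism either, because the image of a
  group is a group.\<close>

lemma tbl_accepts_iff:
  defines "R \<equiv> (\<lambda>a. (\<omega> (free_gen A a), free_gen A a)) ` A"
  shows "tbl_accepts idx ws (card A) n cd \<longleftrightarrow>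
    (\<exists>h \<in> epi (profinite_presentation A R) (table_semigroup n m).
      continuous_map (profinite_presentation_top A R) (discrete_topology {..<n}) h)" (is "_ \<longleftrightarrow> ?R")
proof -
  \<comment> \<open>Homomorphisms ignore the unit, so the right-hand side is the same for every
    choice of \<open>e\<close>.\<close>
  have epi: "epi S (table_semigroup n m) = epi S (\<T> e)" for S :: "('z, 'y) monoid_scheme" and e
    by (simp add: epi_def hom_def table_semigroup_def)
  have accepts: "tbl_accepts idx ws (card A) n cd \<longleftrightarrow> (\<exists>e<n. group (\<T> e) \<and> ?R)"
  proof -
    have "(tbl_group n cd e \<and> (\<exists>z<n ^ card A. tbl_periodic idx ws (card A) n cd e z \<and>
          tbl_generates (card A) n cd e z)) \<longleftrightarrow> group (\<T> e) \<and> ?R" if e: "e < n" for e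
    proof (cases "group (\<T> e)")
      case True
      show ?thesis
        using epi_presentation_iff_periodic[OF True finite_table]
          periodic_generating_tuple_iff[OF e True] True e
        by (simp add: tbl_group_iff epi[of _ e] R_def)
    qed (simp add: e tbl_group_iff)
    then show ?thesis unfolding tbl_accepts_def by blast
  qed
  have "\<exists>e<n. group (\<T> e)" if ?R
  proof -
    have R: "R \<subseteq> carrier (free_profinite A) \<times> carrier (free_profinite A)"
      using omega_power_mem free_gen_mem by (auto simp: R_def)
    obtain g where g: "g \<in> epi (free_profinite A) (table_semigroup n m)"
      using \<open>?R\<close> epi_presentation_iff[OF topspace_free_profinite \<Omega>.m_closed R, of "table_semigroup n m"]
      unfolding profinite_presentation_def profinite_presentation_top_def
      by (auto simp: table_semigroup_def)
    \<comment> \<open>The image of the neutral element is the identity that the search has to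
      find.\<close>
    let ?e = "g \<one>\<^bsub>free_profinite A\<^esub>"
    have "g \<in> hom (free_profinite A) (\<T> undefined)" "g ` carrier (free_profinite A) = {..<n}"
      using g by (auto simp: epi_def table_semigroup_def)
    then have "group (\<T> ?e)" "?e < n"
      using \<Omega>.hom_imp_img_group[of g "\<T> undefined"] \<Omega>.one_closed by auto
    then show ?thesis by blast
  qed
  then show ?thesis unfolding accepts by blast
qed

end

end

theorem corollary3p3:
  fixes A :: "'a set"
    and \<phi> :: "'a fword \<Rightarrow> 'a fword"
    and R :: "('a fprofinite \<times> 'a fprofinite) set"
  assumes "finite A"
    and "\<phi> \<in> hom (free_group A) (free_group A)"
    and "R = (\<lambda>a. (omega_power (free_profinite_top A) (profinite_extension A \<phi>) (free_gen A a),
                   free_gen A a)) ` A"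
  shows "decidable_profinite (profinite_presentation A R) (profinite_presentation_top A R)"
proof -
  interpret free_group_endo A \<phi> using assms(1,2) by unfold_locales
  obtain el where el: "bij_betw el {..<card A} A"
    using ex_bij_betw_nat_finite[OF assms(1)] by (auto simp: atLeast0LessThan)
  define idx where "idx = inv_into {..<card A} el"
  have idx: "idx (el i) = i" if "i < card A" for i
    unfolding idx_def using el that by (intro inv_into_f_f) (auto simp: bij_betw_def)
  \<comment> \<open>The size of \<open>A\<close>, its numbering and the words
    \<open>\<phi> [(el i, True)]\<close> are built in; the arguments are only the order of the
    semigroup and the code of its table.\<close>
  let ?f = "\<lambda>xs. of_bool (tbl_accepts idx (\<lambda>i. \<phi> [(el i, True)]) (card A) (xs ! 0) (xs ! 1)) :: nat"
  have "total_recursive 2 ?f" using rec_tbl_accepts by (simp add: numeral_2_eq_2)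
  moreover have "?f [n, table_code n m] =
      (if \<exists>h \<in> epi (profinite_presentation A R) (table_semigroup n m).
         continuous_map (profinite_presentation_top A R) (discrete_topology {..<n}) h then 1 else 0)"
    if "finite_semigroup_table n m" for n m
    unfolding assms(3) using tbl_accepts_iff[OF that el idx] by simp
  ultimately show ?thesis unfolding decidable_profinite_def by blast
qed

end
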